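(* For any attacker strategy, the minimum operator loss computed using nonlinear power flow (NPF) is greater than the corresponding loss computed using linear power flow (LPF), i.e. $$\mathcal{C}_{\mathrm{Mm}}(d)>\widehat{\mathcal{C}}_{\mathrm{Mm}}(d)\qquad\forall\, d\in\mathcal{D}_{\mathrm{k}}.$$ Consequently, the resilience computed using LPF upper bounds the corresponding value computed using NPF, i.e. $$\mathcal{R}_{\mathrm{Mm}}\le\widehat{\mathcal{R}}_{\mathrm{Mm}}.$$
   Context: Network. The distribution network is a tree with node set $\mathcal{N}\cup\{0\}$, $\mathrm{N}=|\mathcal{N}|$, rooted at the substation node $0$, and edge set $\mathcal{E}$; $(i,j)\in\mathcal{E}$ means $i$ is the parent of $j$. Line $(i,j)$ has resistance $r_{ij}$ and reactance $x_{ij}$ with $0<r_{ij}\ll1$, $0<x_{ij}\ll1$. Each node $i\in\mathcal{N}$ has a load with nominal demand $\overline{pc}_i,\overline{qc}_i$ and minimum load control parameter $\underline\beta_i$, and a distributed generator (DG) with maximum active output $\overline{pg}_i$ and maximum ratio $\eta_i\ge0$ of absolute reactive to active output. Loads (resp. DGs) have lower and upper voltage bounds $\underline{\mathrm{vc}}_i,\overline{\mathrm{vc}}_i$ (resp. $\underline{\mathrm{vg}}_i,\overline{\mathrm{vg}}_i$) on squared voltage magnitude; lower bounds are positive. $\nu^{nom}$ is the nominal squared voltage and $\Delta\nu_0$ a given substation voltage drop. Attacker. $\mathcal{D}_{\mathrm{k}}=\{d\in\{0,1\}^{\mathcal{N}}:\sum_{i}d_i\le\mathrm{k}\}$; $d_i=1$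 means the DG at $i$ is disrupted; $\mathrm{k}$ is the attacker's resource budget. Operator. A response is $u=(\beta,pg,qg,kc,kg)$, where $kc_i=1$ (resp. $kg_i=1$) means the load (resp. DG) at $i$ is disconnected. $\mathcal{U}$ is the set of $u$ such that for all $i\in\mathcal{N}$: $0\le pg_i\le\overline{pg}_i(1-kg_i)$, $-\eta_ipg_i\le qg_i\le\eta_ipg_i$, $kg_i,kc_i\in\{0,1\}$, $(1-kc_i)\underline\beta_i\le\beta_i\le 1-kc_i$. $\mathcal{U}(d)$ is the set of $u\in\mathcal{U}$ with $kg_i\ge d_i$ and $pg_i\le\overline{pg}_i(1-d_i)$ for all $i$. Network states. $x=(pc,qc,p,q,P,Q,\nu,\ell)$. For $u\in\mathcal{U}$, $\mathcal{X}(u)$ is the set of $x$ with $\nu_0=\nu^{nom}-\Delta\nu_0$; for all $i\in\mathcal{N}$: $pc_i=\beta_i\overline{pc}_i$, $qc_i=\beta_i\overline{qc}_i$, $kg_i\ge\underline{\mathrm{vg}}_i-\nu_i$, $kg_i\ge\nu_i-\overline{\mathrm{vg}}_i$, $kc_i\ge\underline{\mathrm{vc}}_i-\nu_i$, $kc_i\ge\nu_i-\overline{\mathrm{vc}}_i$, $p_i=pc_i-pg_i$, $q_i=qc_i-qg_i$; and for all $(i,j)\in\mathcal{E}$: $P_{ij}=\sum_{k:(j,k)\in\mathcal{E}}P_{jk}+p_j+r_{ij}\ell_{ij}$, $Q_{ij}=\sum_{k:(j,k)\in\mathcal{E}}Q_{jk}+q_j+x_{ij}\ell_{ij}$, $\nu_j=\nu_i-2r_{ij}P_{ij}-2x_{ij}Q_{ij}+(r_{ij}^2+x_{ij}^2)\ell_{ij}$,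 $\ell_{ij}\nu_i\ge P_{ij}^2+Q_{ij}^2$ (convex relaxation of the NPF equation $\ell_{ij}\nu_i=P_{ij}^2+Q_{ij}^2$; under the NRPF condition below the relaxation is exact, i.e. for fixed net consumption there is a unique NPF solution at which the inequality is tight). $\widehat{\mathcal{X}}(u)$ (LPF) is defined identically except that the last four relations are replaced by $P_{ij}=\sum_{k:(j,k)\in\mathcal{E}}P_{jk}+p_j$, $Q_{ij}=\sum_{k:(j,k)\in\mathcal{E}}Q_{jk}+q_j$, $\nu_j=\nu_i-2(r_{ij}P_{ij}+x_{ij}Q_{ij})$, $\ell_{ij}\nu_i=P_{ij}^2+Q_{ij}^2$. Losses. With $W^{VR},W^{LL},W^{LC}_i,W^{LS}_i\in\mathbb{R}_+$ and $W^{LS}_i\ge W^{LC}_i$, $$L(u,x)=W^{VR}\max_{i\in\mathcal{N}}|\nu^{nom}-\nu_i|+\sum_{i\in\mathcal{N}}W^{LC}_i(1-\beta_i)\overline{pc}_i+\sum_{i\in\mathcal{N}}(W^{LS}_i-W^{LC}_i)kc_i\overline{pc}_i+W^{LL}\sum_{(i,j)\in\mathcal{E}}r_{ij}\ell_{ij},$$ and $\widehat L(u,x)$ is $L$ without the last (line-loss) term. Define $$\mathcal{C}_{\mathrm{Mm}}(d)=\min_{u\in\mathcal{U}(d),\,x\in\mathcal{X}(u)}L(u,x),\qquad \widehat{\mathcal{C}}_{\mathrm{Mm}}(d)=\min_{u\in\mathcal{U}(d),\,x\in\widehat{\mathcal{X}}(u)}\widehat L(u,x),$$ $\mathcal{L}_{\mathrm{Mm}}=\max_{d\in\mathcal{D}_{\mathrm{k}}}\mathcal{C}_{\mathrm{Mm}}(d)$,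 $\widehat{\mathcal{L}}_{\mathrm{Mm}}=\max_{d\in\mathcal{D}_{\mathrm{k}}}\widehat{\mathcal{C}}_{\mathrm{Mm}}(d)$, and, with $\mathcal{L}_{\max}$ the loss incurred when all loads and DGs are disconnected, $\mathcal{R}_{\mathrm{Mm}}=100(1-\mathcal{L}_{\mathrm{Mm}}/\mathcal{L}_{\max})$, $\widehat{\mathcal{R}}_{\mathrm{Mm}}=100(1-\widehat{\mathcal{L}}_{\mathrm{Mm}}/\mathcal{L}_{\max})$. Standing assumption (No Reverse Power Flow, NRPF): with $\mathcal{N}_i$ the node set of the subtree rooted at $i$ (including $i$), $\sum_{j\in\mathcal{N}_i}p_j\ge0$ and $\sum_{j\in\mathcal{N}_i}q_j\ge0$ for all $i\in\mathcal{N}$; this is assumed to hold even when all DGs produce maximum output, i.e. $pg_i=\overline{pg}_i$ and $qg_i=\eta_i\overline{pg}_i$ for all $i\in\mathcal{N}$.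
   Formalization: Strict > fails with zero net consumption; proved: ≥ for all d, > if W^VR+W^LL>0 and some NPF optimum has nonzero net consumption. Assumes NRPF at NPF optima, ν,ℓ≥0, Δν_0≥0, ν_0>0, nominal demands and DG limits ≥0, 0≤β_min≤1, voltage bounds around ν^nom, lower bounds ≤ν_0+1. *)

theory Defs
  imports Complex_Main "HOL-Library.FuncSet"
begin

section \<open>Distribution network\<close>

record 'v network =
  nodes :: "'v set"            \<comment> \<open>without the substation\<close>
  substation :: 'v
  edges :: "('v \<times> 'v) set"    \<comment> \<open>pairs (parent, child)\<close>
  resist :: "'v \<Rightarrow> 'v \<Rightarrow> real"
  react :: "'v \<Rightarrow> 'v \<Rightarrow> real"
  pc_nom :: "'v \<Rightarrow> real"
  qc_nom :: "'v \<Rightarrow> real"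
  beta_min :: "'v \<Rightarrow> real"
  pg_max :: "'v \<Rightarrow> real"
  eta :: "'v \<Rightarrow> real"
  vc_min :: "'v \<Rightarrow> real"
  vc_max :: "'v \<Rightarrow> real"
  vg_min :: "'v \<Rightarrow> real"
  vg_max :: "'v \<Rightarrow> real"
  nu_nom :: real
  nu_drop :: real
  W_VR :: real
  W_LL :: real
  W_LC :: "'v \<Rightarrow> real"
  W_LS :: "'v \<Rightarrow> real"

definition nu_sub :: "'v network \<Rightarrow> real" where
  "nu_sub G = nu_nom G - nu_drop G"

definition rooted_tree :: "'v set \<Rightarrow> 'v \<Rightarrow> ('v \<times> 'v) set \<Rightarrow> bool" where
  "rooted_tree N s E \<longleftrightarrow>
     finite N \<and> s \<notin> N \<and> E \<subseteq> insert s N \<times> N \<and>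
     (\<forall>j\<in>N. \<exists>!i. (i, j) \<in> E) \<and> (\<forall>j\<in>N. (s, j) \<in> E\<^sup>*)"

definition subtree :: "'v network \<Rightarrow> 'v \<Rightarrow> 'v set" where
  "subtree G i = {j \<in> nodes G. (i, j) \<in> (edges G)\<^sup>*}"

definition children :: "'v network \<Rightarrow> 'v \<Rightarrow> 'v set" where
  "children G j = {k. (j, k) \<in> edges G}"

text \<open>
  The nominal voltage respects all voltage bounds, and the substation voltage is positive and
  at most nominal. Voltages are in per unit: the conditions with \<open>nu_sub G + 1\<close> say
  that the connectivity constraints, which are written with the constant 1 in front of the binary
  variables, do not exclude the response in which everything is disconnected.
\<close>

definition distribution_network :: "'v network \<Rightarrow> bool" where
  "distribution_network G \<longleftrightarrow>
     nodes G \<noteq> {} \<and> rooted_tree (nodes G) (substation G) (edges G) \<and>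
     (\<forall>(i, j)\<in>edges G. 0 < resist G i j \<and> 0 < react G i j) \<and>
     (\<forall>i\<in>nodes G. 0 \<le> pc_nom G i \<and> 0 \<le> beta_min G i \<and> beta_min G i \<le> 1 \<and>
        0 \<le> pg_max G i \<and> 0 \<le> eta G i) \<and>
     (\<forall>i\<in>nodes G.
        0 < vc_min G i \<and> vc_min G i \<le> nu_nom G \<and> nu_nom G \<le> vc_max G i \<and>
        0 < vg_min G i \<and> vg_min G i \<le> nu_nom G \<and> nu_nom G \<le> vg_max G i) \<and>
     0 \<le> nu_drop G \<and> 0 < nu_sub G \<and>
     (\<forall>i\<in>nodes G. vc_min G i \<le> nu_sub G + 1 \<and> vg_min G i \<le> nu_sub G + 1) \<and>
     0 \<le> W_VR G \<and> 0 \<le> W_LL G \<and>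
     (\<forall>i\<in>nodes G. 0 \<le> W_LC G i \<and> W_LC G i \<le> W_LS G i)"


section \<open>Attacker and operator\<close>

definition attacks :: "'v network \<Rightarrow> nat \<Rightarrow> ('v \<Rightarrow> real) set" where
  "attacks G k = {d \<in> nodes G \<rightarrow>\<^sub>E {0, 1}. (\<Sum>i\<in>nodes G. d i) \<le> real k}"

record 'v response =
  beta :: "'v \<Rightarrow> real"
  pg :: "'v \<Rightarrow> real"
  qg :: "'v \<Rightarrow> real"
  kc :: "'v \<Rightarrow> real"
  kg :: "'v \<Rightarrow> real"

definition responses :: "'v network \<Rightarrow> 'v response set" where
  "responses G = {u. \<forall>i\<in>nodes G.
     0 \<le> pg u i \<and> pg u i \<le> pg_max G i * (1 - kg u i) \<and>
     - eta G i * pg u i \<le> qg u i \<and> qg u i \<le> eta G i * pg u i \<and>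
     kg u i \<in> {0, 1} \<and> kc u i \<in> {0, 1} \<and>
     (1 - kc u i) * beta_min G i \<le> beta u i \<and> beta u i \<le> 1 - kc u i}"

definition responses_under :: "'v network \<Rightarrow> ('v \<Rightarrow> real) \<Rightarrow> 'v response set" where
  "responses_under G d = {u \<in> responses G. \<forall>i\<in>nodes G.
     d i \<le> kg u i \<and> pg u i \<le> pg_max G i * (1 - d i)}"


section \<open>Network states\<close>

text \<open>
  Quantities on a line carry the parent and the child as arguments; \<open>volt\<close> and \<open>curr\<close> are the
  squared magnitudes of voltage and current.
\<close>

record 'v state =
  pc :: "'v \<Rightarrow> real"
  qc :: "'v \<Rightarrow> real"
  p_net :: "'v \<Rightarrow> real"
  q_net :: "'v \<Rightarrow> real"
  P_flow :: "'v \<Rightarrow> 'v \<Rightarrow> real"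
  Q_flow :: "'v \<Rightarrow> 'v \<Rightarrow> real"
  volt :: "'v \<Rightarrow> real"
  curr :: "'v \<Rightarrow> 'v \<Rightarrow> real"

text \<open>
  The last two conditions express that squared magnitudes are nonnegative. They matter: the cone
  \<open>curr * volt \<ge> P\<^sup>2 + Q\<^sup>2\<close> has a second, unphysical branch on which both factors are negative,
  and there the line losses would be negative.
\<close>

definition node_constraints :: "'v network \<Rightarrow> 'v response \<Rightarrow> 'v state \<Rightarrow> bool" where
  "node_constraints G u x \<longleftrightarrow>
     volt x (substation G) = nu_sub G \<and>
     (\<forall>i\<in>nodes G.
        pc x i = beta u i * pc_nom G i \<and> qc x i = beta u i * qc_nom G i \<and>
        kg u i \<ge> vg_min G i - volt x i \<and> kg u i \<ge> volt x i - vg_max G i \<and>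
        kc u i \<ge> vc_min G i - volt x i \<and> kc u i \<ge> volt x i - vc_max G i \<and>
        p_net x i = pc x i - pg u i \<and> q_net x i = qc x i - qg u i) \<and>
     (\<forall>i\<in>nodes G. 0 \<le> volt x i) \<and>
     (\<forall>(i, j)\<in>edges G. 0 \<le> curr x i j)"

definition npf_states :: "'v network \<Rightarrow> 'v response \<Rightarrow> 'v state set" where
  "npf_states G u = {x. node_constraints G u x \<and> (\<forall>(i, j)\<in>edges G.
     P_flow x i j = (\<Sum>k\<in>children G j. P_flow x j k) + p_net x j + resist G i j * curr x i j \<and>
     Q_flow x i j = (\<Sum>k\<in>children G j. Q_flow x j k) + q_net x j + react G i j * curr x i j \<and>
     volt x j = volt x i - 2 * resist G i j * P_flow x i j - 2 * react G i j * Q_flow x i j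
       + ((resist G i j)\<^sup>2 + (react G i j)\<^sup>2) * curr x i j \<and>
     curr x i j * volt x i \<ge> (P_flow x i j)\<^sup>2 + (Q_flow x i j)\<^sup>2)}"

definition lpf_states :: "'v network \<Rightarrow> 'v response \<Rightarrow> 'v state set" where
  "lpf_states G u = {x. node_constraints G u x \<and> (\<forall>(i, j)\<in>edges G.
     P_flow x i j = (\<Sum>k\<in>children G j. P_flow x j k) + p_net x j \<and>
     Q_flow x i j = (\<Sum>k\<in>children G j. Q_flow x j k) + q_net x j \<and>
     volt x j = volt x i - 2 * (resist G i j * P_flow x i j + react G i j * Q_flow x i j) \<and>
     curr x i j * volt x i = (P_flow x i j)\<^sup>2 + (Q_flow x i j)\<^sup>2)}"

definition no_reverse_flow :: "'v network \<Rightarrow> ('v \<Rightarrow> real) \<Rightarrow> ('v \<Rightarrow> real) \<Rightarrow> bool" where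
  "no_reverse_flow G p q \<longleftrightarrow>
     (\<forall>i\<in>nodes G. 0 \<le> (\<Sum>j\<in>subtree G i. p j) \<and> 0 \<le> (\<Sum>j\<in>subtree G i. q j))"


section \<open>Losses and resilience\<close>

definition lpf_loss :: "'v network \<Rightarrow> 'v response \<Rightarrow> 'v state \<Rightarrow> real" where
  "lpf_loss G u x =
     W_VR G * Max ((\<lambda>i. \<bar>nu_nom G - volt x i\<bar>) ` nodes G)
     + (\<Sum>i\<in>nodes G. W_LC G i * (1 - beta u i) * pc_nom G i)
     + (\<Sum>i\<in>nodes G. (W_LS G i - W_LC G i) * kc u i * pc_nom G i)"

definition npf_loss :: "'v network \<Rightarrow> 'v response \<Rightarrow> 'v state \<Rightarrow> real" where
  "npf_loss G u x =
     lpf_loss G u x + W_LL G * (\<Sum>(i, j)\<in>edges G. resist G i j * curr x i j)"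

definition npf_cost :: "'v network \<Rightarrow> ('v \<Rightarrow> real) \<Rightarrow> real" where
  "npf_cost G d = Inf {npf_loss G u x | u x. u \<in> responses_under G d \<and> x \<in> npf_states G u}"

definition lpf_cost :: "'v network \<Rightarrow> ('v \<Rightarrow> real) \<Rightarrow> real" where
  "lpf_cost G d = Inf {lpf_loss G u x | u x. u \<in> responses_under G d \<and> x \<in> lpf_states G u}"

definition npf_optimal :: "'v network \<Rightarrow> ('v \<Rightarrow> real) \<Rightarrow> ('v response \<times> 'v state) set" where
  "npf_optimal G d = {(u, x). u \<in> responses_under G d \<and> x \<in> npf_states G u \<and>
     (\<forall>u'\<in>responses_under G d. \<forall>x'\<in>npf_states G u'. npf_loss G u x \<le> npf_loss G u' x')}"

text \<open>
  Everything disconnected: no power flows, so every node is at the substation voltage. This state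
  belongs to both power flow models and has the same loss in both.
\<close>

definition off_response :: "'v response" where
  "off_response = \<lparr>beta = \<lambda>_. 0, pg = \<lambda>_. 0, qg = \<lambda>_. 0, kc = \<lambda>_. 1, kg = \<lambda>_. 1\<rparr>"

definition off_state :: "'v network \<Rightarrow> 'v state" where
  "off_state G = \<lparr>pc = \<lambda>_. 0, qc = \<lambda>_. 0, p_net = \<lambda>_. 0, q_net = \<lambda>_. 0,
     P_flow = \<lambda>_ _. 0, Q_flow = \<lambda>_ _. 0, volt = \<lambda>_. nu_sub G, curr = \<lambda>_ _. 0\<rparr>"

definition max_loss :: "'v network \<Rightarrow> real" where
  "max_loss G = npf_loss G off_response (off_state G)"

definition npf_resilience :: "'v network \<Rightarrow> nat \<Rightarrow> real" where
  "npf_resilience G k = 100 * (1 - Max (npf_cost G ` attacks G k) / max_loss G)"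

definition lpf_resilience :: "'v network \<Rightarrow> nat \<Rightarrow> real" where
  "lpf_resilience G k = 100 * (1 - Max (lpf_cost G ` attacks G k) / max_loss G)"

end

(*
  Linearise an optimal nonlinear response: keep the operator's choices and replace the flow on a
  line by the net consumption below it. The nonlinear flow exceeds this by the losses below, so
  every voltage can only rise, while by the absence of reverse flow it stays at most the
  substation, hence the nominal, voltage. The linearised state is therefore feasible with a
  smaller voltage deviation and no line losses. The hypothesis on reverse flow speaks about
  optimal responses, so their existence has to be proved: the currents are bounded through the
  voltage drops, and the minimum is then attained by compactness.
*)

theory Submission
  imports Defs "HOL-Analysis.Analysis"
begin

text \<open>The relaxed cone bounds a current from below only, and the weight of the line losses may
  be zero, so neither the cone nor the cost keeps the currents bounded. The bound comes from the
  voltage equation. There the term in the current raises the lower voltage, but the flows contain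
  the loss on their own line and enter with a factor -2, so the net effect of a current is to lower
  the voltage. This one sign gives the comparison of voltages, its strict form and the compactness.
  Compactness is expressed through finitely many real coordinates, because responses and states are
  records of functions on an arbitrary type, unconstrained off the network. Zero voltages are not
  excluded, since a binary variable relaxes the positive lower bounds by 1; they need care because
  the linear current is a quotient by a voltage.\<close>

section \<open>Subsequences, limits and boundedness for families of real functions\<close>

text \<open>Bolzano-Weierstrass, one function at a time: pass to a subsequence on which the new
  values are monotone, hence convergent because bounded; the convergence obtained earlier survives.
  Only the values \<open>f (y n)\<close> matter, so the points need no topology.\<close>

lemma convergent_subseq_finite:
  fixes F :: "('a \<Rightarrow> real) set" and y :: "nat \<Rightarrow> 'a"
  assumes "finite F" "\<And>f. f \<in> F \<Longrightarrow> Bseq (\<lambda>n. f (y n))"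
  shows "\<exists>r. strict_mono r \<and> (\<forall>f\<in>F. convergent (\<lambda>n. f (y (r n))))"
  using assms
proof (induction F rule: finite_induct)
  case empty
  then show ?case using strict_mono_id by blast
next
  case (insert f F)
  then obtain r where r: "strict_mono r" "\<forall>f\<in>F. convergent (\<lambda>n. f (y (r n)))"
    by blast
  obtain g :: "nat \<Rightarrow> nat" where g: "strict_mono g" "monoseq (\<lambda>n. f (y (r (g n))))"
    using seq_monosub[of "\<lambda>n. f (y (r n))"] by blast
  have rg: "strict_mono (r \<circ> g)"
    using r(1) g(1) by (rule strict_mono_o)
  have "Bseq ((\<lambda>n. f (y n)) \<circ> (r \<circ> g))"
    unfolding comp_def using Bseq_subseq[of "\<lambda>n. f (y n)" "r \<circ> g"] insert.prems by simp
  then have "convergent (\<lambda>n. f (y ((r \<circ> g) n)))"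
    using g(2) by (simp add: Bseq_monoseq_convergent comp_def)
  moreover have "convergent (\<lambda>n. h (y ((r \<circ> g) n)))" if "h \<in> F" for h
    using convergent_subseq_convergent[of "\<lambda>n. h (y (r n))" g] r(2) g(1) that by (simp add: comp_def)
  ultimately show ?case using rg by blast
qed

lemma lim_mono_all:
  fixes a b :: "nat \<Rightarrow> real"
  assumes "a \<longlonglongrightarrow> A" "b \<longlonglongrightarrow> B" "\<forall>n. a n \<le> b n"
  shows "A \<le> B"
  using assms by (intro LIMSEQ_le[of a A b B]) auto

lemma lim_eq_all:
  fixes a b :: "nat \<Rightarrow> real"
  assumes "a \<longlonglongrightarrow> A" "b \<longlonglongrightarrow> B" "\<forall>n. a n = b n"
  shows "A = B"
  using assms LIMSEQ_unique by (metis ext)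

lemma bounded_mult_const:
  fixes f :: "'a \<Rightarrow> real"
  shows "bounded (f ` S) \<Longrightarrow> bounded ((\<lambda>y. c * f y) ` S)"
  using bounded_scaling[of "f ` S" c] by (simp add: image_image)

lemma bounded_sum_image:
  fixes f :: "'i \<Rightarrow> 'a \<Rightarrow> real"
  assumes "\<And>i. i \<in> I \<Longrightarrow> bounded (f i ` S)"
  shows "bounded ((\<lambda>y. \<Sum>i\<in>I. f i y) ` S)"
proof (cases "finite I")
  case True
  then show ?thesis
    using assms by (induction I rule: finite_induct) (auto intro!: bounded_plus_comp simp: image_constant_conv)
qed (simp add: image_constant_conv)

section \<open>Subtrees and flows\<close>

locale dist_network =
  fixes G :: "'v network"
  assumes network: "distribution_network G"
begin

abbreviation "N \<equiv> nodes G"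
abbreviation "s \<equiv> substation G"
abbreviation "E \<equiv> edges G"

text \<open>A line is determined by its lower end, so line losses can be indexed by nodes and summed
  over a subtree together with the net consumption.\<close>

definition parent :: "'v \<Rightarrow> 'v" where
  "parent j = (THE i. (i, j) \<in> E)"

lemma tree: "rooted_tree N s E"
  using network by (simp add: distribution_network_def)

lemma finite_nodes: "finite N"
  using tree by (simp add: rooted_tree_def)

lemma nodes_nonempty: "N \<noteq> {}"
  using network by (simp add: distribution_network_def)

lemma edgeD: "(i, j) \<in> E \<Longrightarrow> i \<in> insert s N \<and> j \<in> N"
  using tree by (auto simp: rooted_tree_def)

lemma substation_no_parent: "(i, s) \<notin> E"
  using tree by (auto simp: rooted_tree_def)

lemma finite_edges: "finite E"
  by (rule finite_subset[of _ "insert s N \<times> N"]) (use edgeD finite_nodes in auto)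

lemma parent_edge:
  assumes "j \<in> N"
  shows "(parent j, j) \<in> E"
proof -
  have "\<exists>!i. (i, j) \<in> E" using tree assms by (simp add: rooted_tree_def)
  then show ?thesis unfolding parent_def by (rule theI')
qed

lemma edge_unique: "(i, j) \<in> E \<Longrightarrow> (i', j) \<in> E \<Longrightarrow> i = i'"
  using tree edgeD[of i j] by (auto simp: rooted_tree_def)

lemma parent_eq: "(i, j) \<in> E \<Longrightarrow> parent j = i"
  using edge_unique parent_edge edgeD by blast

text \<open>Voltages are prescribed at the substation and determined downwards from it, so claims
  about them go along paths from the root. Flows accumulate from the leaves and use
  \<open>wf_converse_edges\<close> instead.\<close>

lemma top_down_induct [consumes 1, case_names root edge]:
  assumes "j \<in> insert s N"
    and root: "P s" and edge: "\<And>i j. (i, j) \<in> E \<Longrightarrow> P i \<Longrightarrow> P j"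
  shows "P j"
proof -
  have "(s, j) \<in> E\<^sup>*"
    using assms(1) tree by (auto simp: rooted_tree_def)
  then show ?thesis
    by (induction rule: rtrancl_induct) (auto intro: root edge)
qed

text \<open>Acyclicity is not part of \<open>rooted_tree\<close>. A cycle through \<open>j\<close>
  enters \<open>j\<close> from its only parent and so passes through that parent too; climbing on
  would give a cycle through the substation, which no line enters.\<close>

lemma no_cycle: "(j, j) \<notin> E\<^sup>+"
proof
  assume cyc: "(j, j) \<in> E\<^sup>+"
  then have "j \<in> insert s N"
    by (metis edgeD insertCI tranclE)
  then have "(j, j) \<notin> E\<^sup>+"
  proof (induction rule: top_down_induct)
    case root
    then show ?case
      using substation_no_parent by (meson tranclE)
  next
    case (edge i j)
    then show ?case
      by (metis edge_unique rtrancl_into_trancl2 tranclD2)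
  qed
  with cyc show False by simp
qed

lemma wf_converse_edges: "wf (E\<inverse>)"
  using finite_acyclic_wf_converse finite_edges no_cycle by (metis acyclic_def)

lemma finite_subtree: "finite (subtree G j)"
  using finite_nodes by (auto simp: subtree_def)

lemma subtree_subset: "subtree G j \<subseteq> N"
  by (auto simp: subtree_def)

lemma self_in_subtree: "j \<in> N \<Longrightarrow> j \<in> subtree G j"
  by (simp add: subtree_def)

lemma finite_children: "finite (children G j)"
  using finite_nodes by (rule rev_finite_subset) (auto simp: children_def dest: edgeD)

lemma subtree_unfold:
  assumes "j \<in> N"
  shows "subtree G j = insert j (\<Union>k\<in>children G j. subtree G k)"
  using assms by (auto simp: subtree_def children_def elim: converse_rtranclE
      intro: converse_rtrancl_into_rtrancl)

text \<open>Since parents are unique, two ancestors of a node are comparable. A path between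
  siblings would enter the lower one from the common parent \<open>j\<close> and thereby close a
  cycle.\<close>

lemma subtrees_disjoint:
  assumes "k \<in> children G j" "k' \<in> children G j" "k \<noteq> k'"
  shows "subtree G k \<inter> subtree G k' = {}"
proof -
  have no_path: "(a, b) \<notin> E\<^sup>*" if "(j, a) \<in> E" "(j, b) \<in> E" "a \<noteq> b" for a b
    using that by (metis edge_unique no_cycle rtrancl_into_trancl2 rtranclE)
  have sv: "single_valued (E\<inverse>)"
    by (auto simp: single_valued_def intro: edge_unique)
  {
    fix m assume "(k, m) \<in> E\<^sup>*" "(k', m) \<in> E\<^sup>*"
    then have "(k, k') \<in> E\<^sup>* \<or> (k', k) \<in> E\<^sup>*"
      using single_valued_confluent[OF sv, of m k k'] by (auto simp: rtrancl_converse)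
    then have False
      using no_path assms by (auto simp: children_def)
  }
  then show ?thesis by (auto simp: subtree_def)
qed

lemma sum_subtree:
  fixes a :: "'v \<Rightarrow> real"
  assumes "j \<in> N"
  shows "sum a (subtree G j) = (\<Sum>k\<in>children G j. sum a (subtree G k)) + a j"
proof -
  have "j \<notin> subtree G k" if "k \<in> children G j" for k
    using that no_cycle[of j] by (auto simp: children_def subtree_def dest: rtrancl_into_trancl2)
  then have "sum a (subtree G j) = a j + sum a (\<Union>k\<in>children G j. subtree G k)"
    using finite_children finite_subtree by (subst subtree_unfold[OF assms]) simp
  also have "sum a (\<Union>k\<in>children G j. subtree G k) = (\<Sum>k\<in>children G j. sum a (subtree G k))"
    using finite_children finite_subtree subtrees_disjoint by (intro sum.UNION_disjoint) auto
  finally show ?thesis by simp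
qed

text \<open>Induction from the leaves upwards. The source term \<open>a\<close> is arbitrary, so
  that it may also contain the loss on the line entering a node.\<close>

lemma flow_eq_subtree_sum:
  fixes a :: "'v \<Rightarrow> real"
  assumes balance: "\<And>i j. (i, j) \<in> E \<Longrightarrow> F i j = (\<Sum>k\<in>children G j. F j k) + a j"
    and "(i, j) \<in> E"
  shows "F i j = sum a (subtree G j)"
  using \<open>(i, j) \<in> E\<close>
proof (induction j arbitrary: i rule: wf_induct_rule[OF wf_converse_edges])
  case (1 j)
  have "F j k = sum a (subtree G k)" if "k \<in> children G j" for k
    using that 1(1)[of k j] by (auto simp: children_def)
  then show ?case
    using balance[OF 1(2)] sum_subtree[of j a] edgeD[OF 1(2)] by simp
qed

text \<open>For \<open>j\<close> in the network this is the path from the substation to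
  \<open>j\<close>, as a set: in a tree a line lies on it exactly when \<open>j\<close> is reachable
  from its lower end.\<close>

definition path_edges :: "'v \<Rightarrow> ('v \<times> 'v) set" where
  "path_edges j = {(a, b) \<in> E. (b, j) \<in> E\<^sup>*}"

lemma path_edges_root: "path_edges s = {}"
  using substation_no_parent by (auto simp: path_edges_def dest: edgeD elim: rtranclE)

lemma path_edges_edge:
  assumes "(i, j) \<in> E"
  shows "path_edges j = insert (i, j) (path_edges i)" "(i, j) \<notin> path_edges i"
proof -
  show "path_edges j = insert (i, j) (path_edges i)"
  proof -
    have step: "(b, j) \<in> E\<^sup>* \<longleftrightarrow> b = j \<or> (b, i) \<in> E\<^sup>*" for b
    proof
      assume "(b, j) \<in> E\<^sup>*"
      then show "b = j \<or> (b, i) \<in> E\<^sup>*"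
        by (rule rtranclE) (use edge_unique[OF assms] in blast)+
    next
      assume "b = j \<or> (b, i) \<in> E\<^sup>*"
      then show "(b, j) \<in> E\<^sup>*"
        using assms by (auto intro: rtrancl_into_rtrancl)
    qed
    show ?thesis
      unfolding path_edges_def step using assms edge_unique[OF assms] by blast
  qed
  show "(i, j) \<notin> path_edges i"
    using assms no_cycle by (auto simp: path_edges_def dest: rtrancl_into_trancl2)
qed

lemma sum_path_edge:
  fixes w :: "'v \<times> 'v \<Rightarrow> real"
  assumes "(i, j) \<in> E"
  shows "sum w (path_edges j) = w (i, j) + sum w (path_edges i)"
proof -
  have "finite (path_edges i)"
    by (rule finite_subset[OF _ finite_edges]) (auto simp: path_edges_def)
  then show ?thesis
    using path_edges_edge[OF assms] by simp
qed

section \<open>Bounds on the operator's variables\<close>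

lemma line_pos: "(i, j) \<in> E \<Longrightarrow> 0 < resist G i j \<and> 0 < react G i j"
  using network by (auto simp: distribution_network_def)

lemma nu_sub_bounds: "0 < nu_sub G" "nu_sub G \<le> nu_nom G"
  using network by (auto simp: distribution_network_def nu_sub_def)

lemma nu_nom_le_max: "i \<in> N \<Longrightarrow> nu_nom G \<le> vg_max G i" "i \<in> N \<Longrightarrow> nu_nom G \<le> vc_max G i"
  using network by (auto simp: distribution_network_def)

lemma node_volt_nonneg: "node_constraints G u x \<Longrightarrow> i \<in> insert s N \<Longrightarrow> 0 \<le> volt x i"
  using nu_sub_bounds by (auto simp: node_constraints_def)

lemma response_bounds:
  assumes "u \<in> responses G" "i \<in> N"
  shows "0 \<le> pg u i" "pg u i \<le> pg_max G i" "\<bar>qg u i\<bar> \<le> eta G i * pg_max G i"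
    "0 \<le> kc u i" "kc u i \<le> 1" "0 \<le> kg u i" "kg u i \<le> 1" "0 \<le> beta u i" "beta u i \<le> 1"
proof -
  have par: "0 \<le> beta_min G i" "0 \<le> pg_max G i" "0 \<le> eta G i"
    using network assms(2) by (auto simp: distribution_network_def)
  have u: "0 \<le> pg u i" "pg u i \<le> pg_max G i * (1 - kg u i)" "- eta G i * pg u i \<le> qg u i"
    "qg u i \<le> eta G i * pg u i" "kg u i \<in> {0, 1}" "kc u i \<in> {0, 1}"
    "(1 - kc u i) * beta_min G i \<le> beta u i" "beta u i \<le> 1 - kc u i"
    using assms by (auto simp: responses_def)
  show 1: "pg u i \<le> pg_max G i"
    using u par by auto
  have "eta G i * pg u i \<le> eta G i * pg_max G i"
    using 1 par by (simp add: mult_left_mono)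
  with u show "\<bar>qg u i\<bar> \<le> eta G i * pg_max G i" by auto
  show "0 \<le> pg u i" "0 \<le> kc u i" "kc u i \<le> 1" "0 \<le> kg u i" "kg u i \<le> 1" "0 \<le> beta u i" "beta u i \<le> 1"
    using u par by auto
qed

lemma Max_voltage_ge: "i \<in> N \<Longrightarrow> \<bar>nu_nom G - volt x i\<bar> \<le> Max ((\<lambda>i. \<bar>nu_nom G - volt x i\<bar>) ` N)"
  using finite_nodes by (intro Max_ge) auto

lemma lpf_loss_nonneg:
  assumes "u \<in> responses G"
  shows "0 \<le> lpf_loss G u x"
proof -
  obtain i where i: "i \<in> N" using nodes_nonempty by blast
  have "0 \<le> Max ((\<lambda>i. \<bar>nu_nom G - volt x i\<bar>) ` N)"
    using Max_voltage_ge[OF i, of x] by linarith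
  then have "0 \<le> W_VR G * Max ((\<lambda>i. \<bar>nu_nom G - volt x i\<bar>) ` N)"
    using network by (simp add: distribution_network_def)
  moreover have "0 \<le> W_LC G j * (1 - beta u j) * pc_nom G j"
    "0 \<le> (W_LS G j - W_LC G j) * kc u j * pc_nom G j" if "j \<in> N" for j
    using that network response_bounds[OF assms that]
    by (auto simp: distribution_network_def)
  ultimately show ?thesis
    unfolding lpf_loss_def by (intro add_nonneg_nonneg sum_nonneg) auto
qed

lemma line_loss_nonneg:
  assumes "node_constraints G u x"
  shows "0 \<le> W_LL G * (\<Sum>(i, j)\<in>E. resist G i j * curr x i j)"
proof -
  have "0 \<le> (\<Sum>(i, j)\<in>E. resist G i j * curr x i j)"
    using assms line_pos by (intro sum_nonneg) (force simp: node_constraints_def)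
  then show ?thesis
    using network by (simp add: distribution_network_def)
qed

section \<open>Nonlinear power flow\<close>

lemma npf_nodes: "x \<in> npf_states G u \<Longrightarrow> node_constraints G u x"
  by (simp add: npf_states_def)

lemma npf_curr_nonneg: "x \<in> npf_states G u \<Longrightarrow> (i, j) \<in> E \<Longrightarrow> 0 \<le> curr x i j"
  by (auto simp: npf_states_def node_constraints_def)

lemma npf_edge:
  assumes "x \<in> npf_states G u" "(i, j) \<in> E"
  shows "P_flow x i j = (\<Sum>k\<in>children G j. P_flow x j k) + p_net x j + resist G i j * curr x i j"
    "Q_flow x i j = (\<Sum>k\<in>children G j. Q_flow x j k) + q_net x j + react G i j * curr x i j"
    "volt x j = volt x i - 2 * resist G i j * P_flow x i j - 2 * react G i j * Q_flow x i j
       + ((resist G i j)\<^sup>2 + (react G i j)\<^sup>2) * curr x i j"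
    "(P_flow x i j)\<^sup>2 + (Q_flow x i j)\<^sup>2 \<le> curr x i j * volt x i"
  using assms unfolding npf_states_def by blast+

lemma npf_flow:
  assumes x: "x \<in> npf_states G u" and "(i, j) \<in> E"
  shows "P_flow x i j = (\<Sum>m\<in>subtree G j. p_net x m + resist G (parent m) m * curr x (parent m) m)"
    "Q_flow x i j = (\<Sum>m\<in>subtree G j. q_net x m + react G (parent m) m * curr x (parent m) m)"
  using assms(2) by (intro flow_eq_subtree_sum; simp add: npf_edge(1,2)[OF x] parent_eq)+

text \<open>Of all losses in the subtree only that on the line itself is kept; the others are
  nonnegative. The argument \<open>*\<close> is run with a general weight \<open>w\<close>, standing
  for resistance and reactance.\<close>

lemma npf_flow_ge:
  assumes x: "x \<in> npf_states G u" and e: "(i, j) \<in> E"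
  shows "sum (p_net x) (subtree G j) + resist G i j * curr x i j \<le> P_flow x i j"
    "sum (q_net x) (subtree G j) + react G i j * curr x i j \<le> Q_flow x i j"
proof -
  have *: "w i j * curr x i j \<le> (\<Sum>m\<in>subtree G j. w (parent m) m * curr x (parent m) m)"
    if w: "\<And>a b. (a, b) \<in> E \<Longrightarrow> 0 < w a b" for w :: "'v \<Rightarrow> 'v \<Rightarrow> real"
  proof -
    have "j \<in> subtree G j" using self_in_subtree edgeD[OF e] by blast
    moreover have "0 \<le> w (parent m) m * curr x (parent m) m" if "m \<in> subtree G j" for m
    proof -
      have "(parent m, m) \<in> E" using that parent_edge subtree_subset by blast
      then show ?thesis using w npf_curr_nonneg[OF x] by (simp add: less_imp_le)
    qed
    ultimately have "w (parent j) j * curr x (parent j) j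
        \<le> (\<Sum>m\<in>subtree G j. w (parent m) m * curr x (parent m) m)"
      using finite_subtree by (intro member_le_sum) auto
    then show ?thesis by (simp add: parent_eq[OF e])
  qed
  show "sum (p_net x) (subtree G j) + resist G i j * curr x i j \<le> P_flow x i j"
    using npf_flow(1)[OF x e] *[of "resist G"] line_pos by (simp add: sum.distrib)
  show "sum (q_net x) (subtree G j) + react G i j * curr x i j \<le> Q_flow x i j"
    using npf_flow(2)[OF x e] *[of "react G"] line_pos by (simp add: sum.distrib)
qed

text \<open>Inserting \<open>npf_flow_ge\<close> into the voltage equation turns the coefficient r^2
  + x^2 of the current into -(r^2 + x^2). Read as a bound on the lower voltage this serves the
  comparison with the linear model, read as a bound on the current it serves compactness.\<close>

lemma npf_volt_drop:
  assumes x: "x \<in> npf_states G u" and e: "(i, j) \<in> E"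
  shows "((resist G i j)\<^sup>2 + (react G i j)\<^sup>2) * curr x i j \<le> volt x i - volt x j
      - 2 * (resist G i j * sum (p_net x) (subtree G j) + react G i j * sum (q_net x) (subtree G j))"
proof -
  have "resist G i j * (sum (p_net x) (subtree G j) + resist G i j * curr x i j)
      \<le> resist G i j * P_flow x i j"
    "react G i j * (sum (q_net x) (subtree G j) + react G i j * curr x i j)
      \<le> react G i j * Q_flow x i j"
    using npf_flow_ge[OF x e] line_pos[OF e] by (simp_all add: mult_left_mono)
  then show ?thesis
    using npf_edge(3)[OF x e] by (simp add: algebra_simps power2_eq_square)
qed

section \<open>Linearisation of a nonlinear state\<close>

text \<open>The explicit solution of the voltage recursion in \<open>lpf_states\<close>.\<close>

definition lin_volt :: "('v \<Rightarrow> real) \<Rightarrow> ('v \<Rightarrow> real) \<Rightarrow> 'v \<Rightarrow> real" where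
  "lin_volt p q j = nu_sub G - (\<Sum>(a, b)\<in>path_edges j.
     2 * (resist G a b * sum p (subtree G b) + react G a b * sum q (subtree G b)))"

text \<open>The node quantities stay, so the state still belongs to the same response. At a nonzero
  voltage the current is forced by the last equation of \<open>lpf_states\<close>.\<close>

definition lin_state :: "'v state \<Rightarrow> 'v state" where
  "lin_state x = x\<lparr>
     P_flow := \<lambda>i j. sum (p_net x) (subtree G j),
     Q_flow := \<lambda>i j. sum (q_net x) (subtree G j),
     volt := lin_volt (p_net x) (q_net x),
     curr := \<lambda>i j. ((sum (p_net x) (subtree G j))\<^sup>2 + (sum (q_net x) (subtree G j))\<^sup>2)
       / lin_volt (p_net x) (q_net x) i\<rparr>"

lemma lin_volt_root: "lin_volt p q s = nu_sub G"
  by (simp add: lin_volt_def path_edges_root)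

lemma lin_volt_edge:
  "(i, j) \<in> E \<Longrightarrow> lin_volt p q j = lin_volt p q i
     - 2 * (resist G i j * sum p (subtree G j) + react G i j * sum q (subtree G j))"
  unfolding lin_volt_def by (subst sum_path_edge) auto

lemma lin_volt_mono:
  assumes "no_reverse_flow G p q" "(i, j) \<in> E"
  shows "lin_volt p q j \<le> lin_volt p q i"
proof -
  have "0 \<le> resist G i j * sum p (subtree G j) + react G i j * sum q (subtree G j)"
    using assms edgeD[of i j] line_pos[of i j] by (auto simp: no_reverse_flow_def)
  then show ?thesis
    using lin_volt_edge[OF assms(2), of p q] by simp
qed

lemma lin_volt_le_sub:
  assumes "no_reverse_flow G p q" "j \<in> insert s N"
  shows "lin_volt p q j \<le> nu_sub G"
  using assms(2)
proof (induction rule: top_down_induct)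
  case (edge i j)
  then show ?case using lin_volt_mono[OF assms(1), of i j] by linarith
qed (simp add: lin_volt_root)

text \<open>The drops caused by net consumption agree in both models and cancel, so the gap between
  linear and nonlinear voltage grows along the line by at least the current term. The growth is kept
  explicit for the strict comparison later.\<close>

lemma npf_volt_le_lin_volt_edge:
  assumes x: "x \<in> npf_states G u" and e: "(i, j) \<in> E"
    and le: "volt x i \<le> lin_volt (p_net x) (q_net x) i"
  shows "volt x j + ((resist G i j)\<^sup>2 + (react G i j)\<^sup>2) * curr x i j
    + (lin_volt (p_net x) (q_net x) i - volt x i) \<le> lin_volt (p_net x) (q_net x) j"
  using npf_volt_drop[OF x e] lin_volt_edge[OF e, of "p_net x" "q_net x"] le by linarith

lemma npf_volt_le_lin_volt:
  assumes x: "x \<in> npf_states G u" and "j \<in> insert s N"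
  shows "volt x j \<le> lin_volt (p_net x) (q_net x) j"
  using assms(2)
proof (induction rule: top_down_induct)
  case root
  then show ?case using npf_nodes[OF x] by (simp add: lin_volt_root node_constraints_def)
next
  case (edge i j)
  have "0 \<le> ((resist G i j)\<^sup>2 + (react G i j)\<^sup>2) * curr x i j"
    using npf_curr_nonneg[OF x edge(1)] by simp
  then show ?case
    using npf_volt_le_lin_volt_edge[OF x edge(1,2)] edge(2) by linarith
qed

text \<open>The product covers zero current as well as zero voltage at the upper end. The cone then
  makes both flows vanish, and each flow dominates a sum of nonnegative consumption and nonnegative
  loss.\<close>

lemma npf_edge_idle:
  assumes x: "x \<in> npf_states G u" and nrf: "no_reverse_flow G (p_net x) (q_net x)"
    and e: "(i, j) \<in> E" and "curr x i j * volt x i \<le> 0"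
  shows "sum (p_net x) (subtree G j) = 0" "sum (q_net x) (subtree G j) = 0"
proof -
  have "(P_flow x i j)\<^sup>2 + (Q_flow x i j)\<^sup>2 \<le> 0"
    using npf_edge(4)[OF x e] assms(4) by linarith
  then have PQ: "P_flow x i j = 0" "Q_flow x i j = 0"
    by (simp_all add: sum_power2_le_zero_iff)
  have "0 \<le> resist G i j * curr x i j" "0 \<le> react G i j * curr x i j"
    using line_pos[OF e] npf_curr_nonneg[OF x e] by simp_all
  moreover have "0 \<le> sum (p_net x) (subtree G j)" "0 \<le> sum (q_net x) (subtree G j)"
    using nrf edgeD[OF e] by (auto simp: no_reverse_flow_def)
  ultimately show "sum (p_net x) (subtree G j) = 0" "sum (q_net x) (subtree G j) = 0"
    using npf_flow_ge[OF x e] PQ by linarith+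
qed

text \<open>Lower voltage bounds survive because voltages only rise; upper bounds hold because
  linear voltages stay below the substation voltage, hence below the nominal one.\<close>

lemma lin_state_feasible:
  assumes u: "u \<in> responses G" and x: "x \<in> npf_states G u" and nrf: "no_reverse_flow G (p_net x) (q_net x)"
  shows "lin_state x \<in> lpf_states G u"
proof -
  let ?v = "lin_volt (p_net x) (q_net x)"
  note nc = npf_nodes[OF x]
  have ge: "volt x i \<le> ?v i" if "i \<in> insert s N" for i
    using npf_volt_le_lin_volt[OF x that] .
  have nonneg: "0 \<le> ?v i" if "i \<in> insert s N" for i
    using node_volt_nonneg[OF nc that] ge[OF that] by linarith
  have upper: "?v i \<le> vg_max G i" "?v i \<le> vc_max G i" if "i \<in> N" for i
    using lin_volt_le_sub[OF nrf, of i] nu_sub_bounds(2) nu_nom_le_max[OF that] that by auto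
  have k_nonneg: "0 \<le> kg u i" "0 \<le> kc u i" if "i \<in> N" for i
    using response_bounds[OF u that] by auto
  have nodes: "node_constraints G u (lin_state x)"
    unfolding node_constraints_def
  proof (intro conjI ballI)
    show "volt (lin_state x) s = nu_sub G"
      by (simp add: lin_state_def lin_volt_root)
    fix i assume i: "i \<in> N"
    show "0 \<le> volt (lin_state x) i" using nonneg i by (simp add: lin_state_def)
    show "pc (lin_state x) i = beta u i * pc_nom G i" "qc (lin_state x) i = beta u i * qc_nom G i"
      "p_net (lin_state x) i = pc (lin_state x) i - pg u i"
      "q_net (lin_state x) i = qc (lin_state x) i - qg u i"
      using nc i by (auto simp: lin_state_def node_constraints_def)
    have "vg_min G i - volt x i \<le> kg u i" "vc_min G i - volt x i \<le> kc u i"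
      using nc i by (auto simp: node_constraints_def)
    then show "vg_min G i - volt (lin_state x) i \<le> kg u i" "vc_min G i - volt (lin_state x) i \<le> kc u i"
      "volt (lin_state x) i - vg_max G i \<le> kg u i" "volt (lin_state x) i - vc_max G i \<le> kc u i"
      using ge[of i] upper[OF i] k_nonneg[OF i] i by (simp_all add: lin_state_def)
  next
    fix e assume "e \<in> E"
    then obtain i j where e: "e = (i, j)" "i \<in> insert s N"
      using edgeD by (cases e) blast
    show "case e of (i, j) \<Rightarrow> 0 \<le> curr (lin_state x) i j"
      using nonneg[OF e(2)] e(1) by (simp add: lin_state_def)
  qed
  have cone: "curr (lin_state x) i j * volt (lin_state x) i
      = (P_flow (lin_state x) i j)\<^sup>2 + (Q_flow (lin_state x) i j)\<^sup>2" if e: "(i, j) \<in> E" for i j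
  proof (cases "?v i = 0")
    \<comment> \<open>Division by zero makes the linear current 0 here. The nonlinear voltage lies
      below \<open>?v i\<close> and is not positive either, so the line is idle and both sides
      vanish.\<close>
    case True
    then have "volt x i \<le> 0" using ge[of i] edgeD[OF e] by auto
    then have "curr x i j * volt x i \<le> 0"
      using npf_curr_nonneg[OF x e] by (simp add: mult_nonneg_nonpos)
    then show ?thesis
      using npf_edge_idle[OF x nrf e] True by (simp add: lin_state_def)
  qed (simp add: lin_state_def)
  have balance: "P_flow (lin_state x) i j
      = (\<Sum>k\<in>children G j. P_flow (lin_state x) j k) + p_net (lin_state x) j"
    "Q_flow (lin_state x) i j
      = (\<Sum>k\<in>children G j. Q_flow (lin_state x) j k) + q_net (lin_state x) j"
    "volt (lin_state x) j = volt (lin_state x) i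
      - 2 * (resist G i j * P_flow (lin_state x) i j + react G i j * Q_flow (lin_state x) i j)"
    if e: "(i, j) \<in> E" for i j
  proof -
    have "j \<in> N" using edgeD[OF e] by blast
    note sum_subtree[OF this, of "p_net x"] sum_subtree[OF this, of "q_net x"]
      lin_volt_edge[OF e, of "p_net x" "q_net x"]
    then show "P_flow (lin_state x) i j
      = (\<Sum>k\<in>children G j. P_flow (lin_state x) j k) + p_net (lin_state x) j"
    "Q_flow (lin_state x) i j
      = (\<Sum>k\<in>children G j. Q_flow (lin_state x) j k) + q_net (lin_state x) j"
    "volt (lin_state x) j = volt (lin_state x) i
      - 2 * (resist G i j * P_flow (lin_state x) i j + react G i j * Q_flow (lin_state x) i j)"
      by (simp_all add: lin_state_def)
  qed
  show ?thesis
    unfolding lpf_states_def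
  proof (intro CollectI conjI ballI)
    fix e assume "e \<in> E"
    then obtain i j where e: "e = (i, j)" "(i, j) \<in> E" by (cases e) blast
    show "case e of (i, j) \<Rightarrow>
       P_flow (lin_state x) i j
         = (\<Sum>k\<in>children G j. P_flow (lin_state x) j k) + p_net (lin_state x) j \<and>
       Q_flow (lin_state x) i j
         = (\<Sum>k\<in>children G j. Q_flow (lin_state x) j k) + q_net (lin_state x) j \<and>
       volt (lin_state x) j = volt (lin_state x) i
         - 2 * (resist G i j * P_flow (lin_state x) i j + react G i j * Q_flow (lin_state x) i j) \<and>
       curr (lin_state x) i j * volt (lin_state x) i
         = (P_flow (lin_state x) i j)\<^sup>2 + (Q_flow (lin_state x) i j)\<^sup>2"
      unfolding e(1) prod.case using balance[OF e(2)] cone[OF e(2)] by (intro conjI)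
  qed (rule nodes)
qed

text \<open>No linear voltage exceeds the nominal one, so its deviation is a plain shortfall, which
  shrinks as the voltage rises.\<close>

lemma lin_deviation_le:
  assumes x: "x \<in> npf_states G u" and nrf: "no_reverse_flow G (p_net x) (q_net x)"
    and i: "i \<in> N"
  shows "\<bar>nu_nom G - volt (lin_state x) i\<bar> = nu_nom G - lin_volt (p_net x) (q_net x) i"
    "\<bar>nu_nom G - volt (lin_state x) i\<bar> \<le> \<bar>nu_nom G - volt x i\<bar>"
proof -
  have "lin_volt (p_net x) (q_net x) i \<le> nu_nom G"
    using lin_volt_le_sub[OF nrf, of i] i nu_sub_bounds(2) by simp
  then show "\<bar>nu_nom G - volt (lin_state x) i\<bar> = nu_nom G - lin_volt (p_net x) (q_net x) i"
    by (simp add: lin_state_def)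
  then show "\<bar>nu_nom G - volt (lin_state x) i\<bar> \<le> \<bar>nu_nom G - volt x i\<bar>"
    using npf_volt_le_lin_volt[OF x, of i] i by simp
qed

abbreviation deviation :: "'v state \<Rightarrow> real" where
  "deviation x \<equiv> Max ((\<lambda>i. \<bar>nu_nom G - volt x i\<bar>) ` N)"

lemma deviation_attained: "\<exists>i\<in>N. deviation x = \<bar>nu_nom G - volt x i\<bar>"
proof -
  have "deviation x \<in> (\<lambda>i. \<bar>nu_nom G - volt x i\<bar>) ` N"
    using finite_nodes nodes_nonempty by (intro Max_in) auto
  then show ?thesis by blast
qed

lemma lin_deviation:
  assumes x: "x \<in> npf_states G u" and nrf: "no_reverse_flow G (p_net x) (q_net x)"
  shows "deviation (lin_state x) \<le> deviation x"
proof -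
  obtain m where "m \<in> N" "deviation (lin_state x) = \<bar>nu_nom G - volt (lin_state x) m\<bar>"
    using deviation_attained by blast
  then show ?thesis
    using lin_deviation_le(2)[OF x nrf, of m] Max_voltage_ge[of m x] by linarith
qed

lemma lin_loss_le:
  assumes x: "x \<in> npf_states G u" and nrf: "no_reverse_flow G (p_net x) (q_net x)"
  shows "lpf_loss G u (lin_state x) \<le> lpf_loss G u x"
  using lin_deviation[OF x nrf] network
  by (simp add: lpf_loss_def distribution_network_def mult_left_mono)

section \<open>Strict improvement when power is consumed\<close>

text \<open>The value at a node is the difference between its subtree sum and those of its children,
  so it vanishes if all subtree sums do; by \<open>nrf\<close> a nonzero subtree sum is
  positive.\<close>

lemma npf_active_edge:
  assumes nrf: "no_reverse_flow G p q"
    and i: "i \<in> N" and active: "p i \<noteq> 0 \<or> q i \<noteq> 0"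
  shows "\<exists>(a, b)\<in>E. 0 < sum p (subtree G b) \<or> 0 < sum q (subtree G b)"
proof (rule ccontr)
  assume "\<not> ?thesis"
  then have "sum p (subtree G b) = 0 \<and> sum q (subtree G b) = 0" if "b \<in> N" for b
    using that parent_edge[OF that] nrf by (force simp: no_reverse_flow_def)
  moreover have "k \<in> N" if "k \<in> children G i" for k
    using that edgeD by (auto simp: children_def)
  ultimately have "p i = 0" "q i = 0"
    using sum_subtree[OF i, of p] sum_subtree[OF i, of q] i by simp_all
  with active show False by simp
qed

text \<open>
  A node of maximal linear deviation either lies below a line with current, where the nonlinear
  voltage is strictly lower, or is still at the substation voltage; in the latter case no
  linear voltage drops at all, so no power flows.
\<close>

lemma lin_deviation_strict:
  assumes x: "x \<in> npf_states G u" and nrf: "no_reverse_flow G (p_net x) (q_net x)"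
    and ab: "(a, b) \<in> E" "0 < sum (p_net x) (subtree G b) \<or> 0 < sum (q_net x) (subtree G b)"
  shows "deviation (lin_state x) < deviation x"
proof -
  let ?v = "lin_volt (p_net x) (q_net x)"
  have dich: "volt x j < ?v j \<or> ?v j = nu_sub G" if "j \<in> insert s N" for j
    using that
  proof (induction rule: top_down_induct)
    case root
    then show ?case by (simp add: lin_volt_root)
  next
    case (edge i j)
    have i: "i \<in> insert s N" using edgeD[OF edge(1)] by blast
    have le: "volt x i \<le> ?v i" using npf_volt_le_lin_volt[OF x i] .
    note step = npf_volt_le_lin_volt_edge[OF x edge(1) le]
    have c0: "0 \<le> curr x i j" by (rule npf_curr_nonneg[OF x edge(1)])
    have coef: "0 < (resist G i j)\<^sup>2 + (react G i j)\<^sup>2"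
      using line_pos[OF edge(1)] by (simp add: add_pos_pos)
    then have loss: "0 \<le> ((resist G i j)\<^sup>2 + (react G i j)\<^sup>2) * curr x i j"
      using c0 by simp
    consider "volt x i < ?v i" | "0 < curr x i j" | "?v i = nu_sub G" "curr x i j = 0"
      using edge(2) c0 by linarith
    then show ?case
    proof cases
      case 1
      then show ?thesis using step loss by linarith
    next
      case 2
      then have "0 < ((resist G i j)\<^sup>2 + (react G i j)\<^sup>2) * curr x i j"
        using coef by simp
      then show ?thesis using step le by linarith
    next
      case 3
      then have "?v j = ?v i"
        using npf_edge_idle[OF x nrf edge(1)] lin_volt_edge[OF edge(1)] by simp
      then show ?thesis using 3 by simp
    qed
  qed
  obtain m where m: "m \<in> N" "deviation (lin_state x) = \<bar>nu_nom G - volt (lin_state x) m\<bar>"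
    using deviation_attained by blast
  have "?v b < ?v a"
  proof -
    have "0 < resist G a b * sum (p_net x) (subtree G b) + react G a b * sum (q_net x) (subtree G b)"
      using ab nrf line_pos[OF ab(1)] edgeD[OF ab(1)]
      by (auto simp: no_reverse_flow_def intro: add_pos_nonneg add_nonneg_pos)
    then show ?thesis using lin_volt_edge[OF ab(1), of "p_net x" "q_net x"] by simp
  qed
  then have "?v b < nu_sub G"
    using lin_volt_le_sub[OF nrf, of a] edgeD[OF ab(1)] by simp
  \<comment> \<open>Linear deviations are shortfalls, so the node \<open>m\<close> of largest
    deviation has the lowest linear voltage.\<close>
  moreover have "?v m \<le> ?v b"
    using Max_voltage_ge[of b "lin_state x"] m edgeD[OF ab(1)] lin_deviation_le(1)[OF x nrf] by auto
  ultimately have "volt x m < ?v m" using dich[of m] m(1) by auto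
  then have "\<bar>nu_nom G - volt (lin_state x) m\<bar> < \<bar>nu_nom G - volt x m\<bar>"
    using lin_deviation_le(1)[OF x nrf m(1)] by linarith
  then show ?thesis
    using m Max_voltage_ge[OF m(1), of x] by linarith
qed

lemma line_loss_pos:
  assumes x: "x \<in> npf_states G u" and nrf: "no_reverse_flow G (p_net x) (q_net x)"
    and ab: "(a, b) \<in> E" "0 < sum (p_net x) (subtree G b) \<or> 0 < sum (q_net x) (subtree G b)"
  shows "0 < (\<Sum>(i, j)\<in>E. resist G i j * curr x i j)"
proof -
  have "curr x a b \<noteq> 0"
    using npf_edge_idle[OF x nrf ab(1)] ab(2) by auto
  then have "0 < resist G a b * curr x a b"
    using npf_curr_nonneg[OF x ab(1)] line_pos[OF ab(1)] by simp
  moreover have "0 \<le> resist G i j * curr x i j" if "(i, j) \<in> E" for i j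
    using npf_curr_nonneg[OF x that] line_pos[OF that] by simp
  ultimately show ?thesis
    using finite_edges ab(1) by (intro sum_pos2[of _ "(a, b)"]) auto
qed

text \<open>Either weight suffices: with \<open>W_VR G\<close> positive the voltage term drops
  strictly, with \<open>W_LL G\<close> positive the discarded line losses are strictly
  positive.\<close>

lemma lin_loss_less:
  assumes x: "x \<in> npf_states G u" and nrf: "no_reverse_flow G (p_net x) (q_net x)"
    and i: "i \<in> N" "p_net x i \<noteq> 0 \<or> q_net x i \<noteq> 0"
    and W: "0 < W_VR G + W_LL G"
  shows "lpf_loss G u (lin_state x) < npf_loss G u x"
proof -
  obtain a b where ab: "(a, b) \<in> E"
    "0 < sum (p_net x) (subtree G b) \<or> 0 < sum (q_net x) (subtree G b)"
    using npf_active_edge[OF nrf i] by auto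
  have "0 \<le> W_VR G" "0 \<le> W_LL G"
    using network by (auto simp: distribution_network_def)
  then consider "0 < W_VR G" | "0 < W_LL G" using W by linarith
  then show ?thesis
  proof cases
    case 1
    then have "lpf_loss G u (lin_state x) < lpf_loss G u x"
      using lin_deviation_strict[OF x nrf ab] by (simp add: lpf_loss_def)
    then show ?thesis
      using line_loss_nonneg[OF npf_nodes[OF x]] by (simp add: npf_loss_def)
  next
    case 2
    then have "0 < W_LL G * (\<Sum>(i, j)\<in>E. resist G i j * curr x i j)"
      using line_loss_pos[OF x nrf ab] by simp
    then show ?thesis
      using lin_loss_le[OF x nrf] by (simp add: npf_loss_def)
  qed
qed

section \<open>Existence of an optimal response\<close>

definition npf_feasible :: "('v \<Rightarrow> real) \<Rightarrow> ('v response \<times> 'v state) set" where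
  "npf_feasible d = {(u, x). u \<in> responses_under G d \<and> x \<in> npf_states G u}"

text \<open>The coordinate functions on which constraints and losses depend. There are finitely
  many, so sequential compactness reduces to bounded real sequences.\<close>

definition components :: "('v response \<times> 'v state \<Rightarrow> real) set" where
  "components =
     insert (\<lambda>y. volt (snd y) s)
     (\<Union>i\<in>N. {\<lambda>y. beta (fst y) i, \<lambda>y. pg (fst y) i, \<lambda>y. qg (fst y) i, \<lambda>y. kc (fst y) i,
        \<lambda>y. kg (fst y) i, \<lambda>y. pc (snd y) i, \<lambda>y. qc (snd y) i, \<lambda>y. p_net (snd y) i,
        \<lambda>y. q_net (snd y) i, \<lambda>y. volt (snd y) i}) \<union>
     (\<Union>e\<in>E. {\<lambda>y. P_flow (snd y) (fst e) (snd e), \<lambda>y. Q_flow (snd y) (fst e) (snd e),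
        \<lambda>y. curr (snd y) (fst e) (snd e)})"

lemma finite_components: "finite components"
  using finite_nodes finite_edges by (simp add: components_def)

text \<open>The bounds are obtained in order of dependence: responses and node quantities, voltages,
  currents through \<open>npf_volt_drop\<close>, and finally flows, which are subtree sums of the
  preceding.\<close>

lemma components_bounded:
  assumes "f \<in> components"
  shows "bounded (f ` npf_feasible d)"
proof -
  let ?K = "npf_feasible d"
  have resp: "fst y \<in> responses G" and st: "snd y \<in> npf_states G (fst y)"
    if "y \<in> ?K" for y
    using that by (auto simp: npf_feasible_def responses_under_def)
  have nc: "pc (snd y) i = pc_nom G i * beta (fst y) i" "qc (snd y) i = qc_nom G i * beta (fst y) i"
    "p_net (snd y) i = pc (snd y) i - pg (fst y) i" "q_net (snd y) i = qc (snd y) i - qg (fst y) i"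
    "volt (snd y) i - vc_max G i \<le> kc (fst y) i" "0 \<le> volt (snd y) i"
    if "y \<in> ?K" "i \<in> N" for y i
    using npf_nodes[OF st[OF that(1)]] that(2) by (auto simp: node_constraints_def)
  have vs: "bounded ((\<lambda>y. volt (snd y) s) ` ?K)"
    using npf_nodes[OF st] by (intro boundedI[of _ "nu_sub G"])
      (use nu_sub_bounds in \<open>auto simp: node_constraints_def\<close>)
  have beta: "bounded ((\<lambda>y. beta (fst y) i) ` ?K)" if "i \<in> N" for i
    using response_bounds[OF resp that] by (intro boundedI[of _ 1]) auto
  have pg: "bounded ((\<lambda>y. pg (fst y) i) ` ?K)" if "i \<in> N" for i
    using response_bounds[OF resp that] by (intro boundedI[of _ "pg_max G i"]) auto
  have qg: "bounded ((\<lambda>y. qg (fst y) i) ` ?K)" if "i \<in> N" for i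
    using response_bounds[OF resp that] by (intro boundedI[of _ "eta G i * pg_max G i"]) auto
  have kc: "bounded ((\<lambda>y. kc (fst y) i) ` ?K)" if "i \<in> N" for i
    using response_bounds[OF resp that] by (intro boundedI[of _ 1]) auto
  have kg: "bounded ((\<lambda>y. kg (fst y) i) ` ?K)" if "i \<in> N" for i
    using response_bounds[OF resp that] by (intro boundedI[of _ 1]) auto
  have pc: "bounded ((\<lambda>y. pc (snd y) i) ` ?K)" if "i \<in> N" for i
    using bounded_mult_const[OF beta[OF that]] nc(1)[OF _ that] by (simp cong: image_cong)
  have qc: "bounded ((\<lambda>y. qc (snd y) i) ` ?K)" if "i \<in> N" for i
    using bounded_mult_const[OF beta[OF that]] nc(2)[OF _ that] by (simp cong: image_cong)
  have p: "bounded ((\<lambda>y. p_net (snd y) i) ` ?K)" if "i \<in> N" for i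
    using bounded_minus_comp[OF pc[OF that] pg[OF that]] nc(3)[OF _ that] by (simp cong: image_cong)
  have q: "bounded ((\<lambda>y. q_net (snd y) i) ` ?K)" if "i \<in> N" for i
    using bounded_minus_comp[OF qc[OF that] qg[OF that]] nc(4)[OF _ that] by (simp cong: image_cong)
  have volt: "bounded ((\<lambda>y. volt (snd y) i) ` ?K)" if "i \<in> N" for i
  \<comment> \<open>The 1 is the largest slack that \<open>kc\<close> can add to the upper voltage
    bound.\<close>
  proof (intro boundedI[of _ "1 + vc_max G i"], clarify)
    fix u x assume y: "(u, x) \<in> ?K"
    show "norm (volt (snd (u, x)) i) \<le> 1 + vc_max G i"
      using nc(5,6)[OF y that] response_bounds(5)[OF resp[OF y] that] by simp
  qed
  have volt': "bounded ((\<lambda>y. volt (snd y) i) ` ?K)" if "i \<in> insert s N" for i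
    using that vs volt by blast
  have curr: "bounded ((\<lambda>y. curr (snd y) i j) ` ?K)" if e: "(i, j) \<in> E" for i j
  proof -
    let ?z = "(resist G i j)\<^sup>2 + (react G i j)\<^sup>2"
    \<comment> \<open>\<open>?g\<close> is \<open>npf_volt_drop\<close> solved for the current; it
      involves only coordinates already known to be bounded.\<close>
    let ?g = "\<lambda>y. inverse ?z * (volt (snd y) i - volt (snd y) j
      - 2 * (resist G i j * (\<Sum>m\<in>subtree G j. p_net (snd y) m)
           + react G i j * (\<Sum>m\<in>subtree G j. q_net (snd y) m)))"
    have z: "0 < ?z" using line_pos[OF e] by (simp add: add_pos_pos)
    have ij: "i \<in> insert s N" "j \<in> insert s N" using edgeD[OF e] by auto
    have "bounded (?g ` ?K)"
      using p q subtree_subset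
      by (intro bounded_mult_const bounded_minus_comp bounded_plus_comp bounded_sum_image
          volt' ij) blast+
    then obtain B where B: "\<And>y. y \<in> ?K \<Longrightarrow> norm (?g y) \<le> B"
      unfolding bounded_iff by blast
    show ?thesis
    proof (intro boundedI[of _ B], clarify)
      fix u x assume y: "(u, x) \<in> ?K"
      have "0 \<le> curr x i j" using npf_curr_nonneg[OF st[OF y] e] by simp
      moreover have "curr x i j \<le> ?g (u, x)"
        using npf_volt_drop[OF st[OF y] e] z by (simp add: field_simps)
      ultimately show "norm (curr (snd (u, x)) i j) \<le> B"
        using B[OF y] by simp
    qed
  qed
  have flow: "bounded ((\<lambda>y. P_flow (snd y) i j) ` ?K)" "bounded ((\<lambda>y. Q_flow (snd y) i j) ` ?K)"
    if e: "(i, j) \<in> E" for i j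
  proof -
    have par: "(parent m, m) \<in> E" if "m \<in> subtree G j" for m
      using that parent_edge subtree_subset by blast
    have "bounded ((\<lambda>y. \<Sum>m\<in>subtree G j. p_net (snd y) m
        + resist G (parent m) m * curr (snd y) (parent m) m) ` ?K)"
      using p subtree_subset
      by (intro bounded_sum_image bounded_plus_comp bounded_mult_const curr par) blast+
    then show "bounded ((\<lambda>y. P_flow (snd y) i j) ` ?K)"
      using npf_flow(1)[OF st e] by (simp cong: image_cong)
    have "bounded ((\<lambda>y. \<Sum>m\<in>subtree G j. q_net (snd y) m
        + react G (parent m) m * curr (snd y) (parent m) m) ` ?K)"
      using q subtree_subset
      by (intro bounded_sum_image bounded_plus_comp bounded_mult_const curr par) blast+
    then show "bounded ((\<lambda>y. Q_flow (snd y) i j) ` ?K)"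
      using npf_flow(2)[OF st e] by (simp cong: image_cong)
  qed
  consider "f = (\<lambda>y. volt (snd y) s)"
    | i where "i \<in> N" "f \<in> {\<lambda>y. beta (fst y) i, \<lambda>y. pg (fst y) i, \<lambda>y. qg (fst y) i,
        \<lambda>y. kc (fst y) i, \<lambda>y. kg (fst y) i, \<lambda>y. pc (snd y) i, \<lambda>y. qc (snd y) i,
        \<lambda>y. p_net (snd y) i, \<lambda>y. q_net (snd y) i, \<lambda>y. volt (snd y) i}"
    | e where "e \<in> E" "f \<in> {\<lambda>y. P_flow (snd y) (fst e) (snd e),
        \<lambda>y. Q_flow (snd y) (fst e) (snd e), \<lambda>y. curr (snd y) (fst e) (snd e)}"
    using assms unfolding components_def by blast
  then show ?thesis
  proof cases
    case 1
    then show ?thesis using vs by simp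
  next
    case 2
    then show ?thesis using beta pg qg kc kg pc qc p q volt by blast
  next
    case 3
    then show ?thesis
      using curr[of "fst e" "snd e"] flow[of "fst e" "snd e"] by auto
  qed
qed

text \<open>
  The components outside the network are unconstrained, so a limit of feasible points is only
  taken in the components that matter.
\<close>

definition limit_point :: "(nat \<Rightarrow> 'v response \<times> 'v state) \<Rightarrow> 'v response \<times> 'v state" where
  "limit_point y = (
     \<lparr>beta = \<lambda>i. lim (\<lambda>n. beta (fst (y n)) i), pg = \<lambda>i. lim (\<lambda>n. pg (fst (y n)) i),
      qg = \<lambda>i. lim (\<lambda>n. qg (fst (y n)) i), kc = \<lambda>i. lim (\<lambda>n. kc (fst (y n)) i),
      kg = \<lambda>i. lim (\<lambda>n. kg (fst (y n)) i)\<rparr>,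
     \<lparr>pc = \<lambda>i. lim (\<lambda>n. pc (snd (y n)) i), qc = \<lambda>i. lim (\<lambda>n. qc (snd (y n)) i),
      p_net = \<lambda>i. lim (\<lambda>n. p_net (snd (y n)) i), q_net = \<lambda>i. lim (\<lambda>n. q_net (snd (y n)) i),
      P_flow = \<lambda>i j. lim (\<lambda>n. P_flow (snd (y n)) i j),
      Q_flow = \<lambda>i j. lim (\<lambda>n. Q_flow (snd (y n)) i j),
      volt = \<lambda>i. lim (\<lambda>n. volt (snd (y n)) i),
      curr = \<lambda>i j. lim (\<lambda>n. curr (snd (y n)) i j)\<rparr>)"

lemma limit_point_component: "f \<in> components \<Longrightarrow> f (limit_point y) = lim (\<lambda>n. f (y n))"
  by (auto simp: components_def limit_point_def)

definition converges_to ::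
    "(nat \<Rightarrow> 'v response \<times> 'v state) \<Rightarrow> 'v response \<times> 'v state \<Rightarrow> bool" where
  "converges_to y z \<longleftrightarrow> (\<forall>f\<in>components. (\<lambda>n. f (y n)) \<longlonglongrightarrow> f z)"

lemma converges_toD:
  assumes "converges_to y z"
  shows "(\<lambda>n. volt (snd (y n)) s) \<longlonglongrightarrow> volt (snd z) s"
    and "i \<in> N \<Longrightarrow> (\<lambda>n. beta (fst (y n)) i) \<longlonglongrightarrow> beta (fst z) i"
    and "i \<in> N \<Longrightarrow> (\<lambda>n. pg (fst (y n)) i) \<longlonglongrightarrow> pg (fst z) i"
    and "i \<in> N \<Longrightarrow> (\<lambda>n. qg (fst (y n)) i) \<longlonglongrightarrow> qg (fst z) i"
    and "i \<in> N \<Longrightarrow> (\<lambda>n. kc (fst (y n)) i) \<longlonglongrightarrow> kc (fst z) i"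
    and "i \<in> N \<Longrightarrow> (\<lambda>n. kg (fst (y n)) i) \<longlonglongrightarrow> kg (fst z) i"
    and "i \<in> N \<Longrightarrow> (\<lambda>n. pc (snd (y n)) i) \<longlonglongrightarrow> pc (snd z) i"
    and "i \<in> N \<Longrightarrow> (\<lambda>n. qc (snd (y n)) i) \<longlonglongrightarrow> qc (snd z) i"
    and "i \<in> N \<Longrightarrow> (\<lambda>n. p_net (snd (y n)) i) \<longlonglongrightarrow> p_net (snd z) i"
    and "i \<in> N \<Longrightarrow> (\<lambda>n. q_net (snd (y n)) i) \<longlonglongrightarrow> q_net (snd z) i"
    and "i \<in> N \<Longrightarrow> (\<lambda>n. volt (snd (y n)) i) \<longlonglongrightarrow> volt (snd z) i"
    and "(i, j) \<in> E \<Longrightarrow> (\<lambda>n. P_flow (snd (y n)) i j) \<longlonglongrightarrow> P_flow (snd z) i j"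
    and "(i, j) \<in> E \<Longrightarrow> (\<lambda>n. Q_flow (snd (y n)) i j) \<longlonglongrightarrow> Q_flow (snd z) i j"
    and "(i, j) \<in> E \<Longrightarrow> (\<lambda>n. curr (snd (y n)) i j) \<longlonglongrightarrow> curr (snd z) i j"
  using assms unfolding converges_to_def components_def by (force simp: ball_Un)+

lemma feasible_responses_limit:
  assumes feas: "\<And>n. y n \<in> npf_feasible d" and conv: "converges_to y z"
  shows "fst z \<in> responses_under G d"
proof -
  note L = converges_toD[OF conv]
  have mem: "fst (y n) \<in> responses_under G d" for n
    using feas[of n] by (auto simp: npf_feasible_def)
  have R: "\<forall>n. 0 \<le> pg (fst (y n)) i" "\<forall>n. pg (fst (y n)) i \<le> pg_max G i * (1 - kg (fst (y n)) i)"
    "\<forall>n. - eta G i * pg (fst (y n)) i \<le> qg (fst (y n)) i" "\<forall>n. qg (fst (y n)) i \<le> eta G i * pg (fst (y n)) i"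
    "\<forall>n. kg (fst (y n)) i \<in> {0, 1}" "\<forall>n. kc (fst (y n)) i \<in> {0, 1}"
    "\<forall>n. (1 - kc (fst (y n)) i) * beta_min G i \<le> beta (fst (y n)) i"
    "\<forall>n. beta (fst (y n)) i \<le> 1 - kc (fst (y n)) i"
    "\<forall>n. d i \<le> kg (fst (y n)) i" "\<forall>n. pg (fst (y n)) i \<le> pg_max G i * (1 - d i)"
    if "i \<in> N" for i
    using mem that unfolding responses_under_def responses_def by blast+
  \<comment> \<open>Binary variables stay binary in the limit because their range is closed; the
    other conditions are weak inequalities.\<close>
  have cl: "closed {0, 1 :: real}" by (simp add: finite_imp_closed)
  have "0 \<le> pg (fst z) i" "pg (fst z) i \<le> pg_max G i * (1 - kg (fst z) i)"
    "- eta G i * pg (fst z) i \<le> qg (fst z) i" "qg (fst z) i \<le> eta G i * pg (fst z) i"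
    "(1 - kc (fst z) i) * beta_min G i \<le> beta (fst z) i"
    "beta (fst z) i \<le> 1 - kc (fst z) i"
    "d i \<le> kg (fst z) i" "pg (fst z) i \<le> pg_max G i * (1 - d i)"
    if i: "i \<in> N" for i
  proof -
    show "0 \<le> pg (fst z) i"
      by (rule lim_mono_all[OF _ _ R(1)[OF i]]; intro tendsto_intros L i)
    show "pg (fst z) i \<le> pg_max G i * (1 - kg (fst z) i)"
      by (rule lim_mono_all[OF _ _ R(2)[OF i]]; intro tendsto_intros L i)
    show "- eta G i * pg (fst z) i \<le> qg (fst z) i"
      by (rule lim_mono_all[OF _ _ R(3)[OF i]]; intro tendsto_intros L i)
    show "qg (fst z) i \<le> eta G i * pg (fst z) i"
      by (rule lim_mono_all[OF _ _ R(4)[OF i]]; intro tendsto_intros L i)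
    show "(1 - kc (fst z) i) * beta_min G i \<le> beta (fst z) i"
      by (rule lim_mono_all[OF _ _ R(7)[OF i]]; intro tendsto_intros L i)
    show "beta (fst z) i \<le> 1 - kc (fst z) i"
      by (rule lim_mono_all[OF _ _ R(8)[OF i]]; intro tendsto_intros L i)
    show "d i \<le> kg (fst z) i"
      by (rule lim_mono_all[OF _ _ R(9)[OF i]]; intro tendsto_intros L i)
    show "pg (fst z) i \<le> pg_max G i * (1 - d i)"
      by (rule lim_mono_all[OF _ _ R(10)[OF i]]; intro tendsto_intros L i)
  qed
  moreover have "kg (fst z) i \<in> {0, 1}" "kc (fst z) i \<in> {0, 1}" if i: "i \<in> N" for i
    using closed_sequentially[OF cl R(5)[OF i, rule_format] L(6)[OF i]]
      closed_sequentially[OF cl R(6)[OF i, rule_format] L(5)[OF i]] .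
  ultimately show ?thesis
    unfolding responses_under_def responses_def by blast
qed

text \<open>Every condition is an equation or a weak inequality between polynomials in finitely many
  coordinates, so it passes to the limit.\<close>

lemma feasible_states_limit:
  assumes feas: "\<And>n. y n \<in> npf_feasible d" and conv: "converges_to y z"
  shows "snd z \<in> npf_states G (fst z)"
proof -
  note L = converges_toD[OF conv]
  have st: "snd (y n) \<in> npf_states G (fst (y n))" for n
    using feas[of n] by (auto simp: npf_feasible_def)
  have C: "\<forall>n. pc (snd (y n)) i = beta (fst (y n)) i * pc_nom G i"
    "\<forall>n. qc (snd (y n)) i = beta (fst (y n)) i * qc_nom G i"
    "\<forall>n. vg_min G i - volt (snd (y n)) i \<le> kg (fst (y n)) i"
    "\<forall>n. volt (snd (y n)) i - vg_max G i \<le> kg (fst (y n)) i"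
    "\<forall>n. vc_min G i - volt (snd (y n)) i \<le> kc (fst (y n)) i"
    "\<forall>n. volt (snd (y n)) i - vc_max G i \<le> kc (fst (y n)) i"
    "\<forall>n. p_net (snd (y n)) i = pc (snd (y n)) i - pg (fst (y n)) i"
    "\<forall>n. q_net (snd (y n)) i = qc (snd (y n)) i - qg (fst (y n)) i"
    "\<forall>n. 0 \<le> volt (snd (y n)) i"
    if "i \<in> N" for i
    using npf_nodes[OF st] that unfolding node_constraints_def by blast+
  have "volt (snd z) s = nu_sub G"
    by (rule lim_eq_all[OF L(1) tendsto_const])
      (use npf_nodes[OF st] in \<open>simp add: node_constraints_def\<close>)
  moreover have
    "pc (snd z) i = beta (fst z) i * pc_nom G i"
    "qc (snd z) i = beta (fst z) i * qc_nom G i"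
    "p_net (snd z) i = pc (snd z) i - pg (fst z) i"
    "q_net (snd z) i = qc (snd z) i - qg (fst z) i" if i: "i \<in> N" for i
  proof -
    show "pc (snd z) i = beta (fst z) i * pc_nom G i"
      by (rule lim_eq_all[OF _ _ C(1)[OF i]]; intro tendsto_intros L i)
    show "qc (snd z) i = beta (fst z) i * qc_nom G i"
      by (rule lim_eq_all[OF _ _ C(2)[OF i]]; intro tendsto_intros L i)
    show "p_net (snd z) i = pc (snd z) i - pg (fst z) i"
      by (rule lim_eq_all[OF _ _ C(7)[OF i]]; intro tendsto_intros L i)
    show "q_net (snd z) i = qc (snd z) i - qg (fst z) i"
      by (rule lim_eq_all[OF _ _ C(8)[OF i]]; intro tendsto_intros L i)
  qed
  moreover have
    "vg_min G i - volt (snd z) i \<le> kg (fst z) i" "volt (snd z) i - vg_max G i \<le> kg (fst z) i"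
    "vc_min G i - volt (snd z) i \<le> kc (fst z) i" "volt (snd z) i - vc_max G i \<le> kc (fst z) i"
    "0 \<le> volt (snd z) i" if i: "i \<in> N" for i
  proof -
    show "vg_min G i - volt (snd z) i \<le> kg (fst z) i"
      by (rule lim_mono_all[OF _ _ C(3)[OF i]]; intro tendsto_intros L i)
    show "volt (snd z) i - vg_max G i \<le> kg (fst z) i"
      by (rule lim_mono_all[OF _ _ C(4)[OF i]]; intro tendsto_intros L i)
    show "vc_min G i - volt (snd z) i \<le> kc (fst z) i"
      by (rule lim_mono_all[OF _ _ C(5)[OF i]]; intro tendsto_intros L i)
    show "volt (snd z) i - vc_max G i \<le> kc (fst z) i"
      by (rule lim_mono_all[OF _ _ C(6)[OF i]]; intro tendsto_intros L i)
    show "0 \<le> volt (snd z) i"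
      by (rule lim_mono_all[OF _ _ C(9)[OF i]]; intro tendsto_intros L i)
  qed
  moreover have curr: "0 \<le> curr (snd z) i j" if e: "(i, j) \<in> E" for i j
    by (rule lim_mono_all[OF tendsto_const L(14)[OF e]]) (use npf_curr_nonneg[OF st e] in blast)
  ultimately have "node_constraints G (fst z) (snd z)"
    unfolding node_constraints_def by blast
  moreover have
    "P_flow (snd z) i j
      = (\<Sum>k\<in>children G j. P_flow (snd z) j k) + p_net (snd z) j + resist G i j * curr (snd z) i j"
    "Q_flow (snd z) i j
      = (\<Sum>k\<in>children G j. Q_flow (snd z) j k) + q_net (snd z) j + react G i j * curr (snd z) i j"
    "volt (snd z) j = volt (snd z) i - 2 * resist G i j * P_flow (snd z) i j
      - 2 * react G i j * Q_flow (snd z) i j + ((resist G i j)\<^sup>2 + (react G i j)\<^sup>2) * curr (snd z) i j"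
    "(P_flow (snd z) i j)\<^sup>2 + (Q_flow (snd z) i j)\<^sup>2 \<le> curr (snd z) i j * volt (snd z) i"
    if e: "(i, j) \<in> E" for i j
  proof -
    have j: "j \<in> N" using edgeD[OF e] by blast
    have ch: "(j, k) \<in> E" if "k \<in> children G j" for k using that by (simp add: children_def)
    \<comment> \<open>The upper end may be the substation, whose voltage is a separate
      coordinate.\<close>
    have vi: "(\<lambda>n. volt (snd (y n)) i) \<longlonglongrightarrow> volt (snd z) i"
      using edgeD[OF e] L(1) L(11)[of i] by blast
    have X: "\<forall>n. P_flow (snd (y n)) i j = (\<Sum>k\<in>children G j. P_flow (snd (y n)) j k)
        + p_net (snd (y n)) j + resist G i j * curr (snd (y n)) i j"
      "\<forall>n. Q_flow (snd (y n)) i j = (\<Sum>k\<in>children G j. Q_flow (snd (y n)) j k)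
        + q_net (snd (y n)) j + react G i j * curr (snd (y n)) i j"
      "\<forall>n. volt (snd (y n)) j = volt (snd (y n)) i - 2 * resist G i j * P_flow (snd (y n)) i j
        - 2 * react G i j * Q_flow (snd (y n)) i j
        + ((resist G i j)\<^sup>2 + (react G i j)\<^sup>2) * curr (snd (y n)) i j"
      "\<forall>n. (P_flow (snd (y n)) i j)\<^sup>2 + (Q_flow (snd (y n)) i j)\<^sup>2
        \<le> curr (snd (y n)) i j * volt (snd (y n)) i"
      using npf_edge[OF st e] by blast+
    show "P_flow (snd z) i j
      = (\<Sum>k\<in>children G j. P_flow (snd z) j k) + p_net (snd z) j + resist G i j * curr (snd z) i j"
      by (rule lim_eq_all[OF _ _ X(1)]; intro tendsto_intros L ch e j)
    show "Q_flow (snd z) i j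
      = (\<Sum>k\<in>children G j. Q_flow (snd z) j k) + q_net (snd z) j + react G i j * curr (snd z) i j"
      by (rule lim_eq_all[OF _ _ X(2)]; intro tendsto_intros L ch e j)
    show "volt (snd z) j = volt (snd z) i - 2 * resist G i j * P_flow (snd z) i j
      - 2 * react G i j * Q_flow (snd z) i j + ((resist G i j)\<^sup>2 + (react G i j)\<^sup>2) * curr (snd z) i j"
      by (rule lim_eq_all[OF L(11)[OF j] _ X(3)]) (intro tendsto_intros vi L(12-14)[OF e])
    show "(P_flow (snd z) i j)\<^sup>2 + (Q_flow (snd z) i j)\<^sup>2 \<le> curr (snd z) i j * volt (snd z) i"
      by (rule lim_mono_all[OF _ _ X(4)]; intro tendsto_intros vi L(12-14)[OF e])
  qed
  ultimately show ?thesis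
    unfolding npf_states_def by blast
qed

text \<open>
  Only lower semicontinuity of the loss is needed, so the maximum is replaced by the deviation at
  a node where the limit attains it.
\<close>

lemma npf_loss_limit:
  assumes conv: "converges_to y z"
    and le: "\<And>n. npf_loss G (fst (y n)) (snd (y n)) \<le> c n" and c: "c \<longlonglongrightarrow> C"
  shows "npf_loss G (fst z) (snd z) \<le> C"
proof -
  note L = converges_toD[OF conv]
  obtain m where m: "m \<in> N" "deviation (snd z) = \<bar>nu_nom G - volt (snd z) m\<bar>"
    using deviation_attained by blast
  define h where "h = (\<lambda>w :: 'v response \<times> 'v state. W_VR G * \<bar>nu_nom G - volt (snd w) m\<bar>
     + (\<Sum>i\<in>N. W_LC G i * (1 - beta (fst w) i) * pc_nom G i)
     + (\<Sum>i\<in>N. (W_LS G i - W_LC G i) * kc (fst w) i * pc_nom G i)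
     + W_LL G * (\<Sum>e\<in>E. resist G (fst e) (snd e) * curr (snd w) (fst e) (snd e)))"
  have E: "(\<lambda>n. curr (snd (y n)) (fst e) (snd e)) \<longlonglongrightarrow> curr (snd z) (fst e) (snd e)"
    if "e \<in> E" for e
    using that L(14)[of "fst e" "snd e"] by simp
  have "(\<lambda>n. h (y n)) \<longlonglongrightarrow> h z"
    unfolding h_def by (intro tendsto_intros L(2,5,11) E m(1))
  moreover have "h (y n) \<le> c n" for n
  proof -
    have "W_VR G * \<bar>nu_nom G - volt (snd (y n)) m\<bar> \<le> W_VR G * deviation (snd (y n))"
      using Max_voltage_ge[OF m(1)] network by (intro mult_left_mono) (auto simp: distribution_network_def)
    then have "h (y n) \<le> npf_loss G (fst (y n)) (snd (y n))"
      by (simp add: h_def npf_loss_def lpf_loss_def split_beta)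
    then show ?thesis using le[of n] by linarith
  qed
  ultimately have "h z \<le> C" using c lim_mono_all by blast
  moreover have "h z = npf_loss G (fst z) (snd z)"
    using m(2) by (simp add: h_def npf_loss_def lpf_loss_def split_beta)
  ultimately show ?thesis by simp
qed

lemma npf_loss_nonneg:
  assumes "u \<in> responses G" "node_constraints G u x"
  shows "0 \<le> npf_loss G u x"
  using lpf_loss_nonneg[OF assms(1)] line_loss_nonneg[OF assms(2)] by (simp add: npf_loss_def)

lemma off_response: "off_response \<in> responses G"
  using network by (auto simp: responses_def off_response_def distribution_network_def)

text \<open>With every binary variable equal to 1 the voltage bounds are relaxed by 1, which is what
  the conditions on \<open>nu_sub G + 1\<close> provide for.\<close>

lemma off_node_constraints: "node_constraints G off_response (off_state G)"
proof -
  have "vg_min G i \<le> nu_sub G + 1" "vc_min G i \<le> nu_sub G + 1" if "i \<in> N" for i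
    using network that by (auto simp: distribution_network_def)
  then have "vg_min G i - nu_sub G \<le> 1" "vc_min G i - nu_sub G \<le> 1"
    "nu_sub G - vg_max G i \<le> 1" "nu_sub G - vc_max G i \<le> 1" if "i \<in> N" for i
    using nu_sub_bounds(2) nu_nom_le_max[OF that] that by force+
  then show ?thesis
    using nu_sub_bounds(1)
    by (simp add: node_constraints_def off_response_def off_state_def split_beta)
qed

lemma off_feasible:
  assumes "d \<in> attacks G k"
  shows "(off_response, off_state G) \<in> npf_feasible d"
proof -
  have "d i \<le> 1 \<and> 0 \<le> pg_max G i * (1 - d i)" if i: "i \<in> N" for i
  proof -
    have "d i \<in> {0, 1}" using assms i by (auto simp: attacks_def)
    moreover have "0 \<le> pg_max G i" using network i by (simp add: distribution_network_def)
    ultimately show ?thesis by auto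
  qed
  then have "off_response \<in> responses_under G d"
    using off_response by (simp add: responses_under_def off_response_def)
  moreover have "off_state G \<in> npf_states G off_response"
    using off_node_constraints by (simp add: npf_states_def off_state_def split_beta)
  ultimately show ?thesis by (simp add: npf_feasible_def)
qed

lemma npf_optimal_exists:
  assumes "d \<in> attacks G k"
  shows "\<exists>u x. (u, x) \<in> npf_optimal G d"
proof -
  let ?loss = "\<lambda>w. npf_loss G (fst w) (snd w)"
  let ?K = "npf_feasible d"
  define c where "c = Inf (?loss ` ?K)"
  have bdd: "bdd_below (?loss ` ?K)"
  proof (rule bdd_belowI[of _ 0], clarify)
    fix u x assume "(u, x) \<in> ?K"
    then have "u \<in> responses G" "x \<in> npf_states G u"
      by (auto simp: npf_feasible_def responses_under_def)
    then show "0 \<le> ?loss (u, x)" using npf_loss_nonneg npf_nodes by simp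
  qed
  \<comment> \<open>A minimizing sequence; it exists because disconnecting everything is feasible
    under each attack.\<close>
  have "\<exists>w\<in>?K. ?loss w < c + inverse (real (Suc n))" for n
    using cInf_lessD[of "?loss ` ?K" "c + inverse (real (Suc n))"] off_feasible[OF assms]
    by (auto simp: c_def simp del: of_nat_Suc)
  then obtain y where y: "\<And>n. y n \<in> ?K" "\<And>n. ?loss (y n) < c + inverse (real (Suc n))"
    by metis
  have "Bseq (\<lambda>n. f (y n))" if f: "f \<in> components" for f
  proof -
    obtain B where "\<And>w. w \<in> ?K \<Longrightarrow> norm (f w) \<le> B"
      using components_bounded[OF f, of d] by (auto simp: bounded_iff)
    then show ?thesis using y(1) by (intro BseqI') blast
  qed
  then obtain r where r: "strict_mono r" "\<forall>f\<in>components. convergent (\<lambda>n. f (y (r n)))"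
    using convergent_subseq_finite[OF finite_components, of y] by blast
  define z where "z = limit_point (\<lambda>n. y (r n))"
  have conv: "converges_to (\<lambda>n. y (r n)) z"
    using r(2) by (simp add: converges_to_def z_def limit_point_component convergent_LIMSEQ_iff)
  have "(\<lambda>n. c + inverse (real (Suc n))) \<longlonglongrightarrow> c"
    by (rule LIMSEQ_inverse_real_of_nat_add)
  then have "(\<lambda>n. c + inverse (real (Suc (r n)))) \<longlonglongrightarrow> c"
    using LIMSEQ_subseq_LIMSEQ[OF _ r(1)] by (fastforce simp: comp_def)
  then have "?loss z \<le> c"
    using npf_loss_limit[OF conv, of "\<lambda>n. c + inverse (real (Suc (r n)))"] y(2) less_imp_le by blast
  moreover have "c \<le> ?loss w" if "w \<in> ?K" for w
    unfolding c_def using that bdd by (intro cInf_lower) auto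
  moreover have "fst z \<in> responses_under G d" "snd z \<in> npf_states G (fst z)"
    using feasible_responses_limit[OF y(1) conv] feasible_states_limit[OF y(1) conv] .
  ultimately have "(fst z, snd z) \<in> npf_optimal G d"
    unfolding npf_optimal_def npf_feasible_def by fastforce
  then show ?thesis by blast
qed

section \<open>Comparison of the costs\<close>

lemma npf_cost_optimal:
  assumes "(u, x) \<in> npf_optimal G d"
  shows "npf_cost G d = npf_loss G u x"
  unfolding npf_cost_def using assms
  by (intro cInf_eq_minimum) (auto simp: npf_optimal_def)

text \<open>Nonnegative losses make the infimum a genuine lower bound, so one feasible linear state
  is enough; attainment is proved for the nonlinear problem only.\<close>

lemma lpf_cost_le:
  assumes "u \<in> responses_under G d" "x \<in> lpf_states G u"
  shows "lpf_cost G d \<le> lpf_loss G u x"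
  unfolding lpf_cost_def
proof (rule cInf_lower)
  show "bdd_below {lpf_loss G u x |u x. u \<in> responses_under G d \<and> x \<in> lpf_states G u}"
    by (rule bdd_belowI[of _ 0]) (auto simp: responses_under_def intro: lpf_loss_nonneg)
qed (use assms in blast)

lemma npf_optimalD:
  assumes "(u, x) \<in> npf_optimal G d"
  shows "u \<in> responses_under G d" "u \<in> responses G" "x \<in> npf_states G u"
  using assms by (auto simp: npf_optimal_def responses_under_def)

lemma lpf_cost_le_npf_cost:
  assumes opt: "(u, x) \<in> npf_optimal G d" and nrf: "no_reverse_flow G (p_net x) (q_net x)"
  shows "lpf_cost G d \<le> npf_cost G d"
proof -
  note o = npf_optimalD[OF opt]
  have "lpf_cost G d \<le> lpf_loss G u (lin_state x)"
    using lpf_cost_le[OF o(1) lin_state_feasible[OF o(2,3) nrf]] .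
  also have "\<dots> \<le> npf_loss G u x"
    using lin_loss_le[OF o(3) nrf] line_loss_nonneg[OF npf_nodes[OF o(3)]] by (simp add: npf_loss_def)
  finally show ?thesis by (simp add: npf_cost_optimal[OF opt])
qed

lemma lpf_cost_less_npf_cost:
  assumes opt: "(u, x) \<in> npf_optimal G d" and nrf: "no_reverse_flow G (p_net x) (q_net x)"
    and "i \<in> N" "p_net x i \<noteq> 0 \<or> q_net x i \<noteq> 0" "0 < W_VR G + W_LL G"
  shows "lpf_cost G d < npf_cost G d"
proof -
  note o = npf_optimalD[OF opt]
  have "lpf_cost G d \<le> lpf_loss G u (lin_state x)"
    using lpf_cost_le[OF o(1) lin_state_feasible[OF o(2,3) nrf]] .
  also have "\<dots> < npf_loss G u x"
    by (rule lin_loss_less[OF o(3) nrf assms(3-5)])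
  finally show ?thesis by (simp add: npf_cost_optimal[OF opt])
qed

section \<open>From costs to resilience\<close>

lemma finite_attacks: "finite (attacks G k)"
  using finite_nodes finite_PiE[of N "\<lambda>_. {0, 1 :: real}"]
  by (auto simp: attacks_def intro: rev_finite_subset)

lemma no_attack: "restrict (\<lambda>_. 0) N \<in> attacks G k"
  by (auto simp: attacks_def)

lemma resilience_mono:
  assumes "\<And>d. d \<in> attacks G k \<Longrightarrow> lpf_cost G d \<le> npf_cost G d"
  shows "npf_resilience G k \<le> lpf_resilience G k"
proof -
  have "Max (lpf_cost G ` attacks G k) \<le> Max (npf_cost G ` attacks G k)"
  proof (rule Max.boundedI)
    fix c assume "c \<in> lpf_cost G ` attacks G k"
    then obtain d where d: "d \<in> attacks G k" "c = lpf_cost G d" by blast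
    have "npf_cost G d \<le> Max (npf_cost G ` attacks G k)"
      using finite_attacks d(1) by (intro Max_ge) auto
    then show "c \<le> Max (npf_cost G ` attacks G k)"
      using assms[OF d(1)] d(2) by linarith
  qed (use finite_attacks no_attack in auto)
  \<comment> \<open>\<open>max_loss G\<close> may be zero; both quotients are then 0 and the two
    resiliences agree.\<close>
  moreover have "0 \<le> max_loss G"
    unfolding max_loss_def by (rule npf_loss_nonneg[OF off_response off_node_constraints])
  ultimately show ?thesis
    by (simp add: npf_resilience_def lpf_resilience_def divide_right_mono)
qed

end

text \<open>Strictness carries a condition because the costs can coincide: with no demand and no
  generation capacity, no power flows in the linear model and both costs equal
  \<open>W_VR G * nu_drop G\<close>. One optimal pair with nonzero net consumption suffices, since
  all optimal pairs have the same loss.\<close>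

theorem proposition4:
  fixes G :: "'v network" and k :: nat
  assumes network: "distribution_network G"
    and nrpf_max_output:
      "no_reverse_flow G (\<lambda>i. pc_nom G i - pg_max G i) (\<lambda>i. qc_nom G i - eta G i * pg_max G i)"
    and nrpf:
      "\<And>d u x. d \<in> attacks G k \<Longrightarrow> (u, x) \<in> npf_optimal G d \<Longrightarrow>
         no_reverse_flow G (p_net x) (q_net x)"
  shows "(\<forall>d\<in>attacks G k.
            npf_cost G d \<ge> lpf_cost G d \<and>
            (W_VR G + W_LL G > 0 \<and>
             (\<exists>(u, x)\<in>npf_optimal G d. \<exists>i\<in>nodes G. p_net x i \<noteq> 0 \<or> q_net x i \<noteq> 0)
             \<longrightarrow> npf_cost G d > lpf_cost G d)) \<and>
         npf_resilience G k \<le> lpf_resilience G k"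
proof -
  interpret dist_network G by (unfold_locales) (rule network)
  have le: "lpf_cost G d \<le> npf_cost G d" if d: "d \<in> attacks G k" for d
    using npf_optimal_exists[OF d] lpf_cost_le_npf_cost nrpf[OF d] by blast
  moreover have "lpf_cost G d < npf_cost G d"
    if "d \<in> attacks G k" "W_VR G + W_LL G > 0"
      "\<exists>(u, x)\<in>npf_optimal G d. \<exists>i\<in>nodes G. p_net x i \<noteq> 0 \<or> q_net x i \<noteq> 0" for d
    using that lpf_cost_less_npf_cost nrpf[OF that(1)] by blast
  ultimately show ?thesis
    using resilience_mono by blast
qed

end
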